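(* There exists $V^*>0$ such that for every real $V\ge V^*$ there is a solution $u:\mathbb{R}^6\to\mathbb{R}$ of $$(-\Delta)^3 u = 5!\, e^{6u}\quad\text{in }\mathbb{R}^6,\qquad \int_{\mathbb{R}^6} e^{6u(x)}\,dx = V;$$ that is, there exists a metric on $\mathbb{R}^6$ of the form $g_u=e^{2u}|dx|^2$ with $Q$-curvature $Q_{g_u}\equiv 5!$ and $\mathrm{vol}(g_u)=V$.
   Context: $\Delta$ is the Euclidean Laplacian and $|dx|^2$ is the Euclidean metric. Solutions are understood in the classical (smooth) sense. For a conformal metric $g_u=e^{2u}|dx|^2$ on $\mathbb{R}^{2m}$, the $Q$-curvature is $Q_{g_u}=e^{-2mu}(-\Delta)^m u$ and the volume is $\mathrm{vol}(g_u)=\int_{\mathbb{R}^{2m}}e^{2mu}\,dx$; thus the two formulations in the claim are equivalent (here $m=3$). *)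

theory Defs
  imports "HOL-Analysis.Analysis"
begin

definition partial_derivative :: "'a::euclidean_space \<Rightarrow> ('a \<Rightarrow> real) \<Rightarrow> 'a \<Rightarrow> real" where
  "partial_derivative b u x = frechet_derivative u (at x) b"

fun C_k :: "nat \<Rightarrow> ('a::euclidean_space \<Rightarrow> real) \<Rightarrow> bool" where
  "C_k 0 u \<longleftrightarrow> continuous_on UNIV u"
| "C_k (Suc k) u \<longleftrightarrow>
     (\<forall>x. u differentiable (at x)) \<and> (\<forall>b\<in>Basis. C_k k (partial_derivative b u))"

definition smooth :: "('a::euclidean_space \<Rightarrow> real) \<Rightarrow> bool" where
  "smooth u \<longleftrightarrow> (\<forall>k. C_k k u)"

text \<open>The operators below are total because \<^const>\<open>frechet_derivative\<close> is; they have their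
  usual meaning on sufficiently differentiable functions.\<close>

definition laplacian :: "('a::euclidean_space \<Rightarrow> real) \<Rightarrow> 'a \<Rightarrow> real" where
  "laplacian u x = (\<Sum>b\<in>Basis. partial_derivative b (partial_derivative b u) x)"

definition neg_laplacian_power :: "nat \<Rightarrow> ('a::euclidean_space \<Rightarrow> real) \<Rightarrow> 'a \<Rightarrow> real" where
  "neg_laplacian_power m = (\<lambda>w x. - laplacian w x) ^^ m"

text \<open>The next two definitions concern the conformal metric \<open>e^(2u) |dx|^2\<close>, represented by its
  conformal factor \<open>u\<close>, and are meant for dimension \<open>DIM('a) = 2 * m\<close>.\<close>

definition Q_curvature :: "nat \<Rightarrow> ('a::euclidean_space \<Rightarrow> real) \<Rightarrow> 'a \<Rightarrow> real" where
  "Q_curvature m u x = exp (- 2 * real m * u x) * neg_laplacian_power m u x"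

definition conformal_volume :: "nat \<Rightarrow> ('a::euclidean_space \<Rightarrow> real) \<Rightarrow> ennreal" where
  "conformal_volume m u = (\<integral>\<^sup>+ x. ennreal (exp (2 * real m * u x)) \<partial>lborel)"

end

theory Submission
  imports Defs
begin

text \<open>Look for radial solutions \<open>u x = f (x \<bullet> x)\<close>. Inverting the radial Laplacian three times gives the
  Volterra equation \<open>f = P - I\<^sup>3 (120 * exp (6 * f))\<close> with \<open>P q = - t + q - q\<^sup>2 / (1 + t\<^sup>2)\<close>, solvable for every
  \<open>t\<close> by a contraction argument, with solutions depending continuously on \<open>t\<close>. Since \<open>f \<le> P\<close>, the volume is
  finite and, by dominated convergence, continuous in \<open>t\<close>. It is unbounded: if the volume stays below a fixed
  bound, the mass is negligible for \<open>r \<le> t / 2\<close> (where \<open>f r \<le> r - t\<close>) and its effect on the squared Laplacian of \<open>u\<close>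
  decays for \<open>r \<ge> t / 2\<close>, so \<open>f q \<ge> - t + q - K * q\<^sup>2 / t\<^sup>2\<close> with \<open>K\<close> independent of \<open>t\<close>; for \<open>q\<close> of order
  \<open>t\<^sup>2\<close> the right-hand side is nonnegative, which forces a large volume. The intermediate value
  theorem concludes.\<close>

subsection \<open>The inverse of the radial Laplacian\<close>

text \<open>For \<open>q > 0\<close> this is \<open>q ^ (-(j + 1))\<close> times the integral of
  \<open>s ^ j * h s\<close> over \<open>{0..q}\<close>; the rescaled form also makes sense at
  \<open>q = 0\<close> and is continuous there for continuous \<open>h\<close>.\<close>

definition moment :: "nat \<Rightarrow> (real \<Rightarrow> real) \<Rightarrow> real \<Rightarrow> real" where
  "moment j h q = integral {0..1} (\<lambda>s. s ^ j * h (s * q))"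

text \<open>In dimension 6 the Laplacian of \<open>f (x \<bullet> x)\<close> is \<open>4 * q * f'' q + 12 * f' q = 4 * (q\<^sup>3 * f' q)' / q\<^sup>2\<close>
  at \<open>q = x \<bullet> x\<close>. The operator below inverts it, normalised to vanish at \<open>q = 0\<close>; rescaling both integrals to the
  unit interval removes the singularity.\<close>

definition radial_inv :: "(real \<Rightarrow> real) \<Rightarrow> real \<Rightarrow> real" where
  "radial_inv h q = q / 4 * moment 0 (moment 2 h) q"

text \<open>The parameter \<open>t\<close> is carried along because the intermediate value argument
  at the end needs solutions jointly continuous in \<open>t\<close> and \<open>q\<close>.\<close>

lemma continuous_on_moment_param:
  fixes f :: "'a::topological_space \<Rightarrow> real \<Rightarrow> real"
  assumes "continuous_on UNIV (\<lambda>(t, q). f t q)"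
  shows "continuous_on UNIV (\<lambda>(t, q). moment j (f t) q)"
proof -
  have "continuous_on (UNIV \<times> cbox 0 1) (\<lambda>(p, s). s ^ j * f (fst p) (s * snd p))"
  proof -
    have "continuous_on (UNIV \<times> cbox (0::real) 1)
        (\<lambda>z. (\<lambda>(t, q). f t q) (fst (fst z :: 'a \<times> real), snd z * snd (fst z)))"
      by (rule continuous_on_compose2[OF assms]) (auto intro!: continuous_intros)
    then show ?thesis
      by (auto simp: case_prod_unfold intro!: continuous_intros)
  qed
  from integral_continuous_on_param[OF this] show ?thesis
    by (simp add: moment_def case_prod_unfold cbox_interval)
qed

lemma continuous_on_radial_inv_param:
  fixes f :: "'a::topological_space \<Rightarrow> real \<Rightarrow> real"
  assumes "continuous_on UNIV (\<lambda>(t, q). f t q)"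
  shows "continuous_on UNIV (\<lambda>(t, q). radial_inv (f t) q)"
  using continuous_on_moment_param[OF continuous_on_moment_param[OF assms, of 2], of 0]
  unfolding radial_inv_def case_prod_unfold by (intro continuous_intros) auto

lemma continuous_on_moment:
  assumes "continuous_on UNIV h"
  shows "continuous_on UNIV (moment j h)"
proof -
  have "continuous_on UNIV (\<lambda>(t::real, q). h q)"
    using continuous_on_compose2[OF assms, of UNIV snd] by (simp add: case_prod_unfold continuous_intros)
  then have "continuous_on UNIV (\<lambda>(t::real, q). moment j h q)"
    by (rule continuous_on_moment_param)
  from continuous_on_compose2[OF this, of UNIV "\<lambda>q. (0, q)"] show ?thesis
    by (simp add: continuous_intros)
qed

lemma continuous_on_radial_inv:
  assumes "continuous_on UNIV h"
  shows "continuous_on UNIV (radial_inv h)"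
  unfolding radial_inv_def
  by (intro continuous_intros continuous_on_moment assms) auto

section \<open>Linearity, monotonicity and values on powers\<close>

lemma moment_integrable:
  assumes "continuous_on UNIV h"
  shows "(\<lambda>s. s ^ j * h (s * q)) integrable_on {0..1::real}"
  by (intro integrable_continuous_interval continuous_intros continuous_on_compose2[OF assms]) auto

lemma moment_diff:
  assumes "continuous_on UNIV h" "continuous_on UNIV k"
  shows "moment j (\<lambda>r. h r - k r) q = moment j h q - moment j k q"
  unfolding moment_def right_diff_distrib
  by (rule integral_diff; rule moment_integrable; rule assms)

lemma moment_cmult: "moment j (\<lambda>r. c * h r) q = c * moment j h q"
  unfolding moment_def by (simp add: mult.left_commute)

lemma moment_power: "moment j (\<lambda>r. r ^ n) q = q ^ n / real (j + n + 1)"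
proof -
  define m where "m = j + n"
  have "((\<lambda>s. s ^ Suc m / real (Suc m)) has_vector_derivative s ^ m) (at s within {0..1})" for s :: real
  proof -
    have "((\<lambda>s. s ^ Suc m / real (Suc m)) has_real_derivative
        real (Suc m) * s ^ (Suc m - Suc 0) / real (Suc m)) (at s within {0..1})"
      by (intro DERIV_cdivide has_field_derivative_at_within[OF DERIV_pow])
    then show ?thesis
      by (simp add: has_real_derivative_iff_has_vector_derivative del: of_nat_Suc)
  qed
  then have "((\<lambda>s::real. s ^ m) has_integral
      (1 ^ Suc m / real (Suc m) - 0 ^ Suc m / real (Suc m))) {0..1}"
    by (intro fundamental_theorem_of_calculus) simp_all
  from has_integral_mult_left[OF this, of "q ^ n"]
  have "integral {0..1} (\<lambda>s. s ^ m * q ^ n) = q ^ n / real (Suc m)"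
    by (intro integral_unique) simp
  then show ?thesis
    unfolding moment_def m_def by (simp add: power_mult_distrib power_add mult.assoc)
qed

lemma moment_mono:
  assumes "continuous_on UNIV h" "continuous_on UNIV k" "0 \<le> q"
    and le: "\<And>r. 0 \<le> r \<Longrightarrow> r \<le> q \<Longrightarrow> h r \<le> k r"
  shows "moment j h q \<le> moment j k q"
  unfolding moment_def
  by (rule integral_le; (rule moment_integrable, rule assms)?)
    (auto intro!: mult_left_mono le mult_left_le_one_le simp: \<open>0 \<le> q\<close>)

lemma moment_cong:
  assumes "0 \<le> q" "\<And>r. 0 \<le> r \<Longrightarrow> r \<le> q \<Longrightarrow> h r = k r"
  shows "moment j h q = moment j k q"
  unfolding moment_def
  by (rule integral_cong) (auto simp: assms mult_left_le_one_le)

lemma radial_inv_mono: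
  assumes "continuous_on UNIV h" "continuous_on UNIV k" "0 \<le> q"
    and "\<And>r. 0 \<le> r \<Longrightarrow> r \<le> q \<Longrightarrow> h r \<le> k r"
  shows "radial_inv h q \<le> radial_inv k q"
  unfolding radial_inv_def using assms
  by (auto intro!: mult_left_mono moment_mono continuous_on_moment)

lemma radial_inv_cong:
  assumes "0 \<le> q" "\<And>r. 0 \<le> r \<Longrightarrow> r \<le> q \<Longrightarrow> h r = k r"
  shows "radial_inv h q = radial_inv k q"
  unfolding radial_inv_def using assms
  by (auto intro!: moment_cong)

lemma radial_inv_diff:
  assumes "continuous_on UNIV h" "continuous_on UNIV k"
  shows "radial_inv (\<lambda>r. h r - k r) q = radial_inv h q - radial_inv k q"
proof -
  have "moment 2 (\<lambda>r. h r - k r) = (\<lambda>r. moment 2 h r - moment 2 k r)"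
    by (rule ext) (rule moment_diff[OF assms])
  then show ?thesis
    unfolding radial_inv_def
    by (simp add: moment_diff continuous_on_moment assms right_diff_distrib)
qed

lemma radial_inv_cmult: "radial_inv (\<lambda>r. c * h r) q = c * radial_inv h q"
proof -
  have "moment 2 (\<lambda>r. c * h r) = (\<lambda>r. c * moment 2 h r)"
    by (rule ext) (rule moment_cmult)
  then show ?thesis
    unfolding radial_inv_def by (simp add: moment_cmult)
qed

text \<open>In dimension 6 the Laplacian of \<open>(x \<bullet> x) ^ (n + 1)\<close> is
  \<open>4 * (n + 1) * (n + 3) * (x \<bullet> x) ^ n\<close>.\<close>

lemma radial_inv_power: "radial_inv (\<lambda>r. r ^ n) q = q ^ (n + 1) / (4 * real ((n + 1) * (n + 3)))"
proof -
  have "moment 2 (\<lambda>r. r ^ n) = (\<lambda>r. 1 / real (2 + n + 1) * r ^ n)"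
    by (rule ext) (simp add: moment_power)
  then show ?thesis
    unfolding radial_inv_def by (simp only: moment_cmult moment_power) (simp add: field_simps)
qed

lemma radial_inv_nonneg:
  assumes "continuous_on UNIV h" "\<And>r. 0 \<le> r \<Longrightarrow> 0 \<le> h r" "0 \<le> q"
  shows "0 \<le> radial_inv h q"
  \<comment> \<open>Zero is written \<open>0 * h r\<close>, so that \<open>radial_inv_cmult\<close>
    evaluates the lower bound.\<close>
  using radial_inv_mono[of "\<lambda>r. 0 * h r" h q] assms by (simp only: radial_inv_cmult) simp

text \<open>The substitution \<open>s * q\<close> undoes the rescaling. This gives access to the
  fundamental theorem of calculus and to mass estimates on balls.\<close>

lemma moment_eq_integral:
  assumes h: "continuous_on UNIV h" and "0 \<le> q"
  shows "q ^ (j + 1) * moment j h q = integral {0..q} (\<lambda>s. s ^ j * h s)"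
proof (cases "q = 0")
  case False
  with assms have q: "q > 0" by simp
  have "(\<lambda>s. s ^ j * h s) integrable_on {0..q}"
    by (intro integrable_continuous_interval continuous_intros continuous_on_subset[OF h]) auto
  then have "((\<lambda>s. s ^ j * h s) has_integral integral {0..q} (\<lambda>s. s ^ j * h s)) {0..q}"
    by (rule integrable_integral)
  from has_integral_stretch_real[OF this False]
  have "((\<lambda>s. q ^ j * (s ^ j * h (s * q))) has_integral
      integral {0..q} (\<lambda>s. s ^ j * h s) / q) {0..1}"
    using q by (simp add: power_mult_distrib mult_ac)
  from integral_unique[OF this] have "q ^ j * moment j h q = integral {0..q} (\<lambda>s. s ^ j * h s) / q"
    by (simp add: moment_def)
  then show ?thesis using q by (simp add: field_simps)
qed simp

lemma moment_0_has_real_derivative: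
  assumes h: "continuous_on UNIV h" and "0 \<le> q"
  shows "((\<lambda>x. x * moment 0 h x) has_real_derivative h q) (at q within {0..})"
proof -
  \<comment> \<open>The fundamental theorem is applied on a compact interval; as its end point
    \<open>q + 1\<close> lies to the right of \<open>q\<close>, the derivative at \<open>q\<close>
    is the same as within the half-line.\<close>
  have "((\<lambda>x. integral {0..x} h) has_real_derivative h q) (at q within {0..q + 1})"
    by (rule integral_has_real_derivative) (use assms in \<open>auto intro: continuous_on_subset\<close>)
  then have "((\<lambda>x. x * moment 0 h x) has_real_derivative h q) (at q within {0..q + 1})"
    by (rule has_field_derivative_transform_within[where d=1])
      (use moment_eq_integral[OF h, of _ 0] assms in auto)
  moreover have "at q within {0..q + 1} = at q within {0..}"
    by (rule at_within_nhd[where S="{..<q + 1}"]) auto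
  ultimately show ?thesis by simp
qed

lemma radial_inv_has_real_derivative:
  assumes "continuous_on UNIV h" "0 \<le> q"
  shows "(radial_inv h has_real_derivative moment 2 h q / 4) (at q within {0..})"
proof -
  have "((\<lambda>x. x * moment 0 (moment 2 h) x / 4) has_real_derivative moment 2 h q / 4) (at q within {0..})"
    by (intro DERIV_cdivide moment_0_has_real_derivative continuous_on_moment assms)
  then show ?thesis by (simp add: radial_inv_def[abs_def])
qed

text \<open>Differentiation under the integral sign; the chain rule contributes the extra factor
  \<open>s\<close> that raises the index.\<close>

lemma moment_has_real_derivative:
  assumes h: "continuous_on UNIV h" and h': "continuous_on {0..} h'" and "0 \<le> q"
    and D: "\<And>q. 0 \<le> q \<Longrightarrow> (h has_real_derivative h' q) (at q within {0..})"
  shows "(moment j h has_real_derivative moment (Suc j) h' q) (at q within {0..})"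
proof -
  have "((\<lambda>x. integral (cbox 0 1) (\<lambda>s. s ^ j * h (s * x))) has_real_derivative
     integral (cbox 0 1) (\<lambda>s. s ^ Suc j * h' (s * q))) (at q within {0..})"
  proof (rule leibniz_rule_field_derivative)
    fix x s :: real assume x: "x \<in> {0..}" and s: "s \<in> cbox 0 1"
    have "((\<lambda>x. h (s * x)) has_real_derivative s * h' (s * x)) (at x within {0..})"
    proof -
      have "(h has_real_derivative h' (s * x)) (at (s * x) within (\<lambda>x. s * x) ` {0..})"
        by (rule DERIV_subset[OF D]) (use x s in auto)
      moreover have "((\<lambda>x. s * x) has_real_derivative s) (at x within {0..})"
        by (auto intro!: derivative_eq_intros)
      ultimately show ?thesis
        using DERIV_image_chain[of h "h' (s * x)" "\<lambda>x. s * x" x "{0..}" s]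
        by (simp add: o_def mult.commute)
    qed
    then show "((\<lambda>x. s ^ j * h (s * x)) has_real_derivative s ^ Suc j * h' (s * x)) (at x within {0..})"
      by (auto intro!: derivative_eq_intros)
  next
    have "continuous_on ({0..} \<times> cbox (0::real) 1) (\<lambda>z. h' (snd z * fst z))"
      by (rule continuous_on_compose2[OF h']) (auto intro!: continuous_intros)
    then show "continuous_on ({0..} \<times> cbox 0 1) (\<lambda>(x, s). s ^ Suc j * h' (s * x))"
      unfolding case_prod_unfold by (intro continuous_intros)
  qed (use moment_integrable[OF h] assms in auto)
  then show ?thesis by (simp add: moment_def[abs_def])
qed

text \<open>Integrates the derivative of \<open>s ^ Suc j * h (s * q)\<close> over the unit
  interval. The case \<open>j = 2\<close> is the identity by which \<open>radial_inv\<close> inverts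
  the radial Laplacian.\<close>

lemma moment_by_parts:
  assumes h: "continuous_on UNIV h" and h': "continuous_on {0..} h'" and "0 \<le> q"
    and D: "\<And>q. 0 \<le> q \<Longrightarrow> (h has_real_derivative h' q) (at q within {0..})"
  shows "(real j + 1) * moment j h q + q * moment (Suc j) h' q = h q"
proof -
  have "((\<lambda>s. (real j + 1) * (s ^ j * h (s * q)) + q * (s ^ Suc j * h' (s * q))) has_integral
      1 ^ Suc j * h (1 * q) - 0 ^ Suc j * h (0 * q)) {0..1}"
  proof (rule fundamental_theorem_of_calculus)
    fix s :: real assume s: "s \<in> {0..1}"
    have "(h has_real_derivative h' (s * q)) (at (s * q) within (\<lambda>s. s * q) ` {0..1})"
      by (rule DERIV_subset[OF D]) (use assms s in auto)
    moreover have "((\<lambda>s. s * q) has_real_derivative q) (at s within {0..1})"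
      by (auto intro!: derivative_eq_intros)
    ultimately have "((\<lambda>s. h (s * q)) has_real_derivative h' (s * q) * q) (at s within {0..1})"
      using DERIV_image_chain[of h "h' (s * q)" "\<lambda>s. s * q" s "{0..1}" q]
      by (simp add: o_def)
    then have "((\<lambda>s. s ^ Suc j * h (s * q)) has_real_derivative
        (real j + 1) * (s ^ j * h (s * q)) + q * (s ^ Suc j * h' (s * q))) (at s within {0..1})"
      by (auto intro!: derivative_eq_intros simp: algebra_simps simp del: power_Suc)
    then show "((\<lambda>s. s ^ Suc j * h (s * q)) has_vector_derivative
        (real j + 1) * (s ^ j * h (s * q)) + q * (s ^ Suc j * h' (s * q))) (at s within {0..1})"
      by (simp add: has_real_derivative_iff_has_vector_derivative)
  qed simp
  then have 1: "integral {0..1} (\<lambda>s. (real j + 1) * (s ^ j * h (s * q)) + q * (s ^ Suc j * h' (s * q))) = h q"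
    by (simp add: integral_unique)
  have "continuous_on {0..1} (\<lambda>s. h' (s * q))"
    by (rule continuous_on_compose2[OF h']) (use \<open>0 \<le> q\<close> in \<open>auto intro!: continuous_intros\<close>)
  then have "(\<lambda>s. s ^ Suc j * h' (s * q)) integrable_on {0..1}"
    by (intro integrable_continuous_interval continuous_intros)
  then have "integral {0..1} (\<lambda>s. (real j + 1) * (s ^ j * h (s * q)) + q * (s ^ Suc j * h' (s * q)))
    = (real j + 1) * moment j h q + q * moment (Suc j) h' q"
    unfolding moment_def
    by (subst integral_add) (auto intro!: integrable_on_mult_right moment_integrable h)
  with 1 show ?thesis by simp
qed

subsection \<open>Smoothness on the half-line\<close>

text \<open>One-sided derivatives at 0 suffice, as \<open>x \<bullet> x\<close> never leaves the half-line.\<close>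

fun half_C_k :: "nat \<Rightarrow> (real \<Rightarrow> real) \<Rightarrow> bool" where
  "half_C_k 0 f \<longleftrightarrow> continuous_on {0..} f"
| "half_C_k (Suc k) f \<longleftrightarrow>
     (\<exists>f'. (\<forall>q\<ge>0. (f has_real_derivative f' q) (at q within {0..})) \<and> half_C_k k f')"

lemma half_C_k_SucI:
  assumes "\<And>q. 0 \<le> q \<Longrightarrow> (f has_real_derivative f' q) (at q within {0..})" "half_C_k k f'"
  shows "half_C_k (Suc k) f"
  using assms by auto

lemma half_C_k_SucD: "half_C_k (Suc k) f \<Longrightarrow> half_C_k k f"
proof (induction k arbitrary: f)
  case 0
  then show ?case
    by (auto simp: continuous_on_eq_continuous_within intro: DERIV_continuous)
next
  case (Suc k)
  then obtain f' where f': "\<forall>q\<ge>0. (f has_real_derivative f' q) (at q within {0..})"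
    "half_C_k (Suc k) f'" by auto
  from Suc.IH[OF f'(2)] f'(1) show ?case by auto
qed

lemma half_C_k_imp_continuous_on: "half_C_k k f \<Longrightarrow> continuous_on {0..} f"
proof (induction k)
  case (Suc k)
  then show ?case by (blast dest: half_C_k_SucD)
qed simp

lemma half_line_derivative_cong:
  assumes "\<And>q. 0 \<le> q \<Longrightarrow> f q = g q" "0 \<le> (q::real)"
    and "(f has_real_derivative d) (at q within {0..})"
  shows "(g has_real_derivative d) (at q within {0..})"
  using assms(3) by (rule has_field_derivative_transform_within[where d=1]) (use assms in auto)

lemma half_C_k_cong:
  assumes "half_C_k k f" and eq: "\<And>q. 0 \<le> q \<Longrightarrow> f q = g q"
  shows "half_C_k k g"
proof (cases k)
  case 0
  then show ?thesis using assms continuous_on_eq[of "{0..}" f g] by simp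
next
  case (Suc l)
  then obtain f' where "\<And>q. 0 \<le> q \<Longrightarrow> (f has_real_derivative f' q) (at q within {0..})" "half_C_k l f'"
    using assms by auto
  then show ?thesis
    unfolding Suc by (intro half_C_k_SucI[of g f']) (rule half_line_derivative_cong[of f g]; simp add: eq)
qed

lemma half_C_k_const: "half_C_k k (\<lambda>_. c)"
proof (induction k arbitrary: c)
  case (Suc k)
  show ?case by (rule half_C_k_SucI[OF _ Suc.IH[of 0]]) simp
qed simp

lemma half_C_k_add: "half_C_k k f \<Longrightarrow> half_C_k k g \<Longrightarrow> half_C_k k (\<lambda>q. f q + g q)"
proof (induction k arbitrary: f g)
  case (Suc k)
  then obtain f' g' where *: "\<forall>q\<ge>0. (f has_real_derivative f' q) (at q within {0..})" "half_C_k k f'"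
    "\<forall>q\<ge>0. (g has_real_derivative g' q) (at q within {0..})" "half_C_k k g'" by auto
  show ?case
    by (rule half_C_k_SucI[OF _ Suc.IH[OF *(2,4)]]) (use * DERIV_add in blast)
qed (auto intro: continuous_intros)

lemma half_C_k_mult: "half_C_k k f \<Longrightarrow> half_C_k k g \<Longrightarrow> half_C_k k (\<lambda>q. f q * g q)"
proof (induction k arbitrary: f g)
  case (Suc k)
  then obtain f' g' where *: "\<forall>q\<ge>0. (f has_real_derivative f' q) (at q within {0..})" "half_C_k k f'"
    "\<forall>q\<ge>0. (g has_real_derivative g' q) (at q within {0..})" "half_C_k k g'" by auto
  have "half_C_k k (\<lambda>q. f' q * g q + g' q * f q)"
    by (intro half_C_k_add Suc.IH * half_C_k_SucD[OF Suc.prems(1)] half_C_k_SucD[OF Suc.prems(2)])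
  then show ?case
    by (rule half_C_k_SucI[rotated]) (use * DERIV_mult in blast)
qed (auto intro: continuous_intros)

lemma half_C_k_exp: "half_C_k k f \<Longrightarrow> half_C_k k (\<lambda>q. exp (f q))"
proof (induction k arbitrary: f)
  case (Suc k)
  then obtain f' where *: "\<forall>q\<ge>0. (f has_real_derivative f' q) (at q within {0..})" "half_C_k k f'"
    by auto
  have "half_C_k k (\<lambda>q. exp (f q) * f' q)"
    by (intro half_C_k_mult Suc.IH half_C_k_SucD[OF Suc.prems] *)
  then show ?case
    by (rule half_C_k_SucI[rotated]) (use * DERIV_chain2[OF DERIV_exp] in blast)
qed (auto intro: continuous_intros)

text \<open>Each derivative raises the index of the moment by one, hence the induction with
  arbitrary \<open>j\<close>.\<close>

lemma half_C_k_moment: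
  assumes "half_C_k k h"
  shows "half_C_k k (moment j h)"
  using assms
proof (induction k arbitrary: h j)
  case (0 h j)
  \<comment> \<open>the lemmas on \<^const>\<open>moment\<close> want continuity on the whole line, hence the even extension\<close>
  define h0 where "h0 q = h \<bar>q\<bar>" for q
  have "continuous_on UNIV h0"
    unfolding h0_def by (rule continuous_on_compose2[of "{0..}" h]) (use 0 in \<open>auto intro!: continuous_intros\<close>)
  from continuous_on_subset[OF continuous_on_moment[OF this], of "{0..}" j]
  have "continuous_on {0..} (moment j h0)" by simp
  moreover have "moment j h0 q = moment j h q" if "0 \<le> q" for q
    using that by (rule moment_cong) (simp add: h0_def)
  ultimately show ?case using continuous_on_eq[of "{0..}" "moment j h0" "moment j h"] by simp
next
  case (Suc k h j)
  then obtain h' where *: "\<forall>q\<ge>0. (h has_real_derivative h' q) (at q within {0..})" "half_C_k k h'"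
    by auto
  define h0 where "h0 q = h \<bar>q\<bar>" for q
  have cont: "continuous_on {0..} h" using Suc.prems by (rule half_C_k_imp_continuous_on)
  have c0: "continuous_on UNIV h0"
    unfolding h0_def by (rule continuous_on_compose2[of "{0..}" h]) (use cont in \<open>auto intro!: continuous_intros\<close>)
  have "(h0 has_real_derivative h' q) (at q within {0..})" if "0 \<le> q" for q
    by (rule half_line_derivative_cong[of h]) (use * that in \<open>auto simp: h0_def\<close>)
  with c0 *(2) have "(moment j h0 has_real_derivative moment (Suc j) h' q) (at q within {0..})"
    if "0 \<le> q" for q
    using that by (intro moment_has_real_derivative half_C_k_imp_continuous_on)
  then have "half_C_k (Suc k) (moment j h0)"
    using Suc.IH[OF *(2)] by (rule half_C_k_SucI)
  moreover have "moment j h0 q = moment j h q" if "0 \<le> q" for q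
    using that by (rule moment_cong) (simp add: h0_def)
  ultimately show ?case by (rule half_C_k_cong)
qed

text \<open>The gain of one derivative drives the bootstrapping for solutions of the integral
  equation.\<close>

lemma half_C_k_radial_inv:
  assumes "continuous_on UNIV h" "half_C_k k h"
  shows "half_C_k (Suc k) (radial_inv h)"
proof (rule half_C_k_SucI)
  show "half_C_k k (\<lambda>q. 1 / 4 * moment 2 h q)"
    by (intro half_C_k_mult half_C_k_const half_C_k_moment assms)
qed (use radial_inv_has_real_derivative[OF assms(1)] in simp)

subsection \<open>Radial functions\<close>

lemma C_k_SucD: "C_k (Suc k) u \<Longrightarrow> C_k k u"
proof (induction k arbitrary: u)
  case 0
  then show ?case
    by (auto intro!: continuous_at_imp_continuous_on differentiable_imp_continuous_within)
next
  case (Suc k)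
  then show ?case by (metis C_k.simps(2))
qed

lemma partial_derivative_eqI:
  "(u has_derivative D) (at x) \<Longrightarrow> partial_derivative b u x = D b"
  unfolding partial_derivative_def by (simp add: frechet_derivative_at[symmetric])

lemma C_k_const: "C_k k (\<lambda>x::'a::euclidean_space. c)"
proof (induction k arbitrary: c)
  case (Suc k)
  have "partial_derivative b (\<lambda>x::'a. c) = (\<lambda>x. 0)" for b
    by (rule ext) (rule partial_derivative_eqI, rule has_derivative_const)
  then show ?case using Suc.IH by simp
qed simp

lemma C_k_inner: "C_k k (\<lambda>x. x \<bullet> c)"
proof (cases k)
  case (Suc l)
  have "partial_derivative b (\<lambda>x. x \<bullet> c) = (\<lambda>x. b \<bullet> c)" for b :: 'a
    by (rule ext) (rule partial_derivative_eqI, auto intro!: derivative_eq_intros)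
  then show ?thesis using Suc by (simp add: C_k_const)
qed (simp add: continuous_intros)

lemma C_k_add: "C_k k u \<Longrightarrow> C_k k v \<Longrightarrow> C_k k (\<lambda>x. u x + v x)"
proof (induction k arbitrary: u v)
  case (Suc k)
  have "partial_derivative b (\<lambda>x. u x + v x)
      = (\<lambda>x. partial_derivative b u x + partial_derivative b v x)" for b
  proof
    fix x
    have "(u has_derivative frechet_derivative u (at x)) (at x)"
      "(v has_derivative frechet_derivative v (at x)) (at x)"
      using Suc.prems by (auto simp: frechet_derivative_works)
    from has_derivative_add[OF this] show "partial_derivative b (\<lambda>x. u x + v x) x
      = partial_derivative b u x + partial_derivative b v x"
      by (simp add: partial_derivative_eqI partial_derivative_def[of b u] partial_derivative_def[of b v])
  qed
  then show ?case using Suc by simp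
qed (auto intro: continuous_intros)

lemma C_k_mult: "C_k k u \<Longrightarrow> C_k k v \<Longrightarrow> C_k k (\<lambda>x. u x * v x)"
proof (induction k arbitrary: u v)
  case (Suc k)
  have "partial_derivative b (\<lambda>x. u x * v x)
      = (\<lambda>x. u x * partial_derivative b v x + partial_derivative b u x * v x)" for b
  proof
    fix x
    have "(u has_derivative frechet_derivative u (at x)) (at x)"
      "(v has_derivative frechet_derivative v (at x)) (at x)"
      using Suc.prems by (auto simp: frechet_derivative_works)
    from has_derivative_mult[OF this] show "partial_derivative b (\<lambda>x. u x * v x) x
      = u x * partial_derivative b v x + partial_derivative b u x * v x"
      by (simp add: partial_derivative_eqI partial_derivative_def[of b u] partial_derivative_def[of b v])
  qed
  moreover have "C_k k (\<lambda>x. u x * partial_derivative b v x + partial_derivative b u x * v x)"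
    if "b \<in> Basis" for b
  proof -
    have "C_k k (partial_derivative b u)" "C_k k (partial_derivative b v)"
      using that Suc.prems by simp_all
    then show ?thesis
      by (intro C_k_add Suc.IH C_k_SucD[OF Suc.prems(1)] C_k_SucD[OF Suc.prems(2)])
  qed
  ultimately show ?case using Suc.prems by (simp add: differentiable_mult)
qed (auto intro: continuous_intros)

lemma has_derivative_radial:
  fixes x :: "'a::euclidean_space"
  assumes "(f has_real_derivative d) (at (x \<bullet> x) within {0..})"
  shows "((\<lambda>x. f (x \<bullet> x)) has_derivative (\<lambda>h. 2 * (x \<bullet> h) * d)) (at x)"
proof -
  have "((\<lambda>x. x \<bullet> x) has_derivative (\<lambda>h. 2 * (x \<bullet> h))) (at x)"
    by (auto intro!: derivative_eq_intros simp: inner_commute)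
  moreover have "(f has_derivative (*) d) (at (x \<bullet> x) within range (\<lambda>x::'a. x \<bullet> x))"
    by (rule has_derivative_subset) (use assms in \<open>auto simp: has_field_derivative_def\<close>)
  ultimately show ?thesis
    by (auto dest: has_derivative_in_compose simp: mult_ac)
qed

text \<open>A partial derivative of a radial function is a linear function times a radial one, so
  the product rule closes the induction.\<close>

lemma C_k_radial: "half_C_k k f \<Longrightarrow> C_k k (\<lambda>x::'a::euclidean_space. f (x \<bullet> x))"
proof (induction k arbitrary: f)
  case 0
  have "continuous_on UNIV (\<lambda>x. f (x \<bullet> x))"
    by (rule continuous_on_compose2[of "{0..}" f]) (use 0 in \<open>auto intro!: continuous_intros\<close>)
  then show ?case by simp
next
  case (Suc k)
  then obtain f' where *: "\<forall>q\<ge>0. (f has_real_derivative f' q) (at q within {0..})" "half_C_k k f'"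
    by auto
  have D: "((\<lambda>x. f (x \<bullet> x)) has_derivative (\<lambda>h. 2 * (x \<bullet> h) * f' (x \<bullet> x))) (at x)" for x :: 'a
    by (rule has_derivative_radial) (use * in simp)
  have "partial_derivative b (\<lambda>x. f (x \<bullet> x)) = (\<lambda>x. 2 * (x \<bullet> b) * f' (x \<bullet> x))" for b :: 'a
    by (rule ext) (rule partial_derivative_eqI[OF D])
  moreover have "C_k k (\<lambda>x. 2 * (x \<bullet> b) * f' (x \<bullet> x))" for b :: 'a
    by (intro C_k_mult C_k_const C_k_inner Suc.IH *)
  ultimately show ?case using D by (auto simp: differentiable_def)
qed

lemma laplacian_radial:
  assumes f: "\<And>q. 0 \<le> q \<Longrightarrow> (f has_real_derivative f' q) (at q within {0..})"
    and f': "\<And>q. 0 \<le> q \<Longrightarrow> (f' has_real_derivative f'' q) (at q within {0..})"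
  shows "laplacian (\<lambda>x::'a::euclidean_space. f (x \<bullet> x)) x
    = 4 * (x \<bullet> x) * f'' (x \<bullet> x) + 2 * real DIM('a) * f' (x \<bullet> x)"
proof -
  have 1: "partial_derivative b (\<lambda>x::'a. f (x \<bullet> x)) = (\<lambda>x. 2 * (x \<bullet> b) * f' (x \<bullet> x))" for b
    by (rule ext) (rule partial_derivative_eqI[OF has_derivative_radial[OF f]], simp)
  have "((\<lambda>x. 2 * (x \<bullet> b) * f' (x \<bullet> x)) has_derivative
      (\<lambda>h. 2 * (x \<bullet> b) * (2 * (x \<bullet> h) * f'' (x \<bullet> x)) + 2 * (h \<bullet> b) * f' (x \<bullet> x))) (at x)" for b
  proof -
    have "((\<lambda>x. 2 * (x \<bullet> b)) has_derivative (\<lambda>h. 2 * (h \<bullet> b))) (at x)"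
      by (auto intro!: derivative_eq_intros)
    from has_derivative_mult[OF this has_derivative_radial[OF f'[OF inner_ge_zero]]]
    show ?thesis .
  qed
  from partial_derivative_eqI[OF this]
  have "partial_derivative b (partial_derivative b (\<lambda>x. f (x \<bullet> x))) x
      = 4 * f'' (x \<bullet> x) * ((x \<bullet> b) * (x \<bullet> b)) + 2 * f' (x \<bullet> x)" if "b \<in> Basis" for b
    using that unfolding 1 by (simp add: algebra_simps)
  then have "laplacian (\<lambda>x. f (x \<bullet> x)) x
      = (\<Sum>b\<in>Basis. 4 * f'' (x \<bullet> x) * ((x \<bullet> b) * (x \<bullet> b)) + 2 * f' (x \<bullet> x))"
    unfolding laplacian_def by simp
  also have "\<dots> = 4 * f'' (x \<bullet> x) * (x \<bullet> x) + 2 * real DIM('a) * f' (x \<bullet> x)"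
    by (simp add: sum.distrib sum_distrib_left[symmetric] euclidean_inner[symmetric])
  finally show ?thesis by (simp add: mult_ac)
qed

text \<open>The constant \<open>c\<close> and the factor \<open>a\<close> cover all three Laplacians
  of the final computation; \<open>F\<close> is prescribed only for \<open>q \<ge> 0\<close>, where
  \<open>x \<bullet> x\<close> takes its values.\<close>

lemma laplacian_radial_inv:
  assumes "DIM('a::euclidean_space) = 6"
    and h: "continuous_on UNIV h" "half_C_k 1 h"
    and F: "\<And>q. 0 \<le> q \<Longrightarrow> F q = c + a * radial_inv h q"
  shows "laplacian (\<lambda>x::'a. F (x \<bullet> x)) x = a * h (x \<bullet> x)"
proof -
  from h(2) obtain h' where h': "\<And>q. 0 \<le> q \<Longrightarrow> (h has_real_derivative h' q) (at q within {0..})"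
    "continuous_on {0..} h'" by auto
  have "((\<lambda>q. c + a * radial_inv h q) has_real_derivative a / 4 * moment 2 h q) (at q within {0..})"
    if "0 \<le> q" for q
    using radial_inv_has_real_derivative[OF h(1) that] by (auto intro!: derivative_eq_intros)
  from this[THEN half_line_derivative_cong[rotated 2]] have 1: "(F has_real_derivative a / 4 * moment 2 h q) (at q within {0..})" if "0 \<le> q" for q
    using that F by auto
  have 2: "((\<lambda>q. a / 4 * moment 2 h q) has_real_derivative a / 4 * moment 3 h' q) (at q within {0..})"
    if "0 \<le> q" for q
    using DERIV_cmult[OF moment_has_real_derivative[OF h(1) h'(2) that h'(1), of 2], of "a / 4"] by simp
  have "laplacian (\<lambda>x::'a. F (x \<bullet> x)) x
      = a * (3 * moment 2 h (x \<bullet> x) + (x \<bullet> x) * moment 3 h' (x \<bullet> x))"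
    using laplacian_radial[OF 1 2, where 'a='a] assms(1) by (simp add: algebra_simps)
  also have "\<dots> = a * h (x \<bullet> x)"
    using moment_by_parts[OF h(1) h'(2) inner_ge_zero h'(1), of 2 x] by simp
  finally show ?thesis .
qed

subsection \<open>The integral equation\<close>

text \<open>Bounds by \<open>C * exp (L * |q|)\<close> amount to bounds in the weighted norm of the
  contraction argument.\<close>

lemma moment_abs_le_exp:
  assumes h: "continuous_on UNIV h" and le: "\<And>r. \<bar>h r\<bar> \<le> C * exp (L * \<bar>r\<bar>)" and "0 \<le> L"
  shows "\<bar>moment j h q\<bar> \<le> C * exp (L * \<bar>q\<bar>)"
proof -
  have C: "0 \<le> C" using le[of 0] by simp
  have "norm (integral {0..1} (\<lambda>s. s ^ j * h (s * q))) \<le> integral {0..1} (\<lambda>s::real. C * exp (L * \<bar>q\<bar>))"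
  proof (rule integral_norm_bound_integral)
    fix s :: real assume s: "s \<in> {0..1}"
    have "\<bar>s ^ j * h (s * q)\<bar> \<le> 1 * \<bar>h (s * q)\<bar>"
      unfolding abs_mult by (rule mult_right_mono) (use s in \<open>auto simp: power_le_one\<close>)
    also have "\<dots> \<le> C * exp (L * \<bar>s * q\<bar>)" using le by simp
    also have "\<dots> \<le> C * exp (L * \<bar>q\<bar>)"
      using s C \<open>0 \<le> L\<close> by (intro mult_left_mono) (auto simp: abs_mult intro!: mult_left_mono mult_left_le_one_le)
    finally show "norm (s ^ j * h (s * q)) \<le> C * exp (L * \<bar>q\<bar>)" by simp
  qed (use moment_integrable[OF h] in auto)
  then show ?thesis by (simp add: moment_def)
qed

text \<open>Integrating the exponential in the outer moment produces the gain \<open>1 / L\<close>;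
  the factor \<open>1 / 4\<close> of \<open>radial_inv\<close> is given away.\<close>

lemma radial_inv_abs_le_exp:
  assumes h: "continuous_on UNIV h" and le: "\<And>r. \<bar>h r\<bar> \<le> C * exp (L * \<bar>r\<bar>)" and L: "0 < L"
  shows "\<bar>radial_inv h q\<bar> \<le> C / L * exp (L * \<bar>q\<bar>)"
proof -
  define g where "g = moment 2 h"
  have g: "continuous_on UNIV g" "\<And>r. \<bar>g r\<bar> \<le> C * exp (L * \<bar>r\<bar>)"
    unfolding g_def using assms by (auto intro: continuous_on_moment moment_abs_le_exp)
  have C: "0 \<le> C" using le[of 0] by simp
  have "((\<lambda>s. \<bar>q\<bar> * (C * exp (L * \<bar>q\<bar> * s))) has_integral
      C / L * exp (L * \<bar>q\<bar> * 1) - C / L * exp (L * \<bar>q\<bar> * 0)) {0..1}"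
    by (rule fundamental_theorem_of_calculus)
      (use L in \<open>auto intro!: derivative_eq_intros simp: has_real_derivative_iff_has_vector_derivative[symmetric]\<close>)
  then have I: "((\<lambda>s. \<bar>q\<bar> * (C * exp (L * \<bar>q\<bar> * s))) has_integral C / L * (exp (L * \<bar>q\<bar>) - 1)) {0..1}"
    by (simp add: algebra_simps)
  have "norm (integral {0..1} (\<lambda>s. \<bar>q\<bar> * g (s * q))) \<le> integral {0..1} (\<lambda>s. \<bar>q\<bar> * (C * exp (L * \<bar>q\<bar> * s)))"
  proof (rule integral_norm_bound_integral)
    show "(\<lambda>s. \<bar>q\<bar> * g (s * q)) integrable_on {0..1}"
      using moment_integrable[OF g(1), of 0] by (simp add: integrable_on_mult_right)
    show "(\<lambda>s. \<bar>q\<bar> * (C * exp (L * \<bar>q\<bar> * s))) integrable_on {0..1}"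
      using I by blast
    fix s :: real assume s: "s \<in> {0..1}"
    then show "norm (\<bar>q\<bar> * g (s * q)) \<le> \<bar>q\<bar> * (C * exp (L * \<bar>q\<bar> * s))"
      using mult_left_mono[OF g(2)[of "s * q"], of "\<bar>q\<bar>"] by (simp add: abs_mult mult_ac)
  qed
  then have "\<bar>q\<bar> * \<bar>moment 0 g q\<bar> \<le> C / L * (exp (L * \<bar>q\<bar>) - 1)"
    unfolding integral_unique[OF I] by (simp add: moment_def abs_mult)
  also have "\<dots> \<le> C / L * exp (L * \<bar>q\<bar>)"
    using C L by (intro mult_left_mono) auto
  finally have *: "\<bar>q\<bar> * \<bar>moment 0 g q\<bar> \<le> C / L * exp (L * \<bar>q\<bar>)" .
  have "\<bar>radial_inv h q\<bar> = \<bar>q\<bar> * \<bar>moment 0 g q\<bar> / 4"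
    by (simp add: radial_inv_def g_def abs_mult)
  also have "\<dots> \<le> \<bar>q\<bar> * \<bar>moment 0 g q\<bar>" by simp
  finally show ?thesis using * by linarith
qed

abbreviation radial_inv3 :: "(real \<Rightarrow> real) \<Rightarrow> real \<Rightarrow> real" where
  "radial_inv3 h \<equiv> radial_inv (radial_inv (radial_inv h))"

lemma radial_inv3_diff:
  assumes "continuous_on UNIV h" "continuous_on UNIV k"
  shows "radial_inv3 (\<lambda>r. h r - k r) q = radial_inv3 h q - radial_inv3 k q"
proof -
  have D: "radial_inv (\<lambda>r. h r - k r) = (\<lambda>r. radial_inv h r - radial_inv k r)"
    if "continuous_on UNIV h" "continuous_on UNIV k" for h k
    by (rule ext) (rule radial_inv_diff[OF that])
  show ?thesis
    unfolding D[OF assms] by (subst D) (auto intro!: continuous_on_radial_inv assms radial_inv_diff)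
qed

text \<open>Of the three factors \<open>1 / L\<close> one is kept; it already makes the operator
  contractive once \<open>L\<close> is large.\<close>

lemma radial_inv3_abs_le_exp:
  assumes "continuous_on UNIV h" "\<And>r. \<bar>h r\<bar> \<le> C * exp (L * \<bar>r\<bar>)" and L: "1 \<le> L"
  shows "\<bar>radial_inv3 h q\<bar> \<le> C / L * exp (L * \<bar>q\<bar>)"
proof -
  have C: "0 \<le> C" using assms(2)[of 0] by simp
  have "\<bar>radial_inv3 h q\<bar> \<le> C / L / L / L * exp (L * \<bar>q\<bar>)"
    using assms by (intro radial_inv_abs_le_exp continuous_on_radial_inv) auto
  also have "\<dots> \<le> C / L * exp (L * \<bar>q\<bar>)"
  proof (rule mult_right_mono)
    have "C / L / L \<le> C / L" "C / L / L / L \<le> C / L / L"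
      using C L by (simp_all add: divide_le_eq mult_le_cancel_left1)
    then show "C / L / L / L \<le> C / L" by linarith
  qed simp
  finally show ?thesis .
qed

text \<open>By symmetry \<open>x \<le> y\<close>; then factor out \<open>exp (- x) \<le> 1\<close>
  and use \<open>1 - exp (- z) \<le> z\<close>. This yields the Lipschitz constant of the
  nonlinearity.\<close>

lemma abs_exp_neg_diff_le:
  fixes x y :: real
  assumes "0 \<le> x" "0 \<le> y"
  shows "\<bar>exp (- x) - exp (- y)\<bar> \<le> \<bar>x - y\<bar>"
proof -
  have *: "exp (- x) - exp (- y) \<le> y - x" if "0 \<le> x" "x \<le> y" for x y :: real
  proof -
    have "1 - exp (- (y - x)) \<le> y - x"
      using exp_ge_add_one_self[of "- (y - x)"] by linarith
    moreover have "exp (- x) - exp (- y) = exp (- x) * (1 - exp (- (y - x)))"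
      by (simp add: right_diff_distrib exp_add[symmetric])
    moreover have "exp (- x) * (1 - exp (- (y - x))) \<le> 1 * (1 - exp (- (y - x)))"
      using that by (intro mult_right_mono) auto
    ultimately show ?thesis by simp
  qed
  show ?thesis
    using *[of x y] *[of y x] assms by (cases "x \<le> y") auto
qed

text \<open>The weight \<open>exp (- L t * \<bar>q\<bar>)\<close> makes the integral operator a contraction for all parameters at once,
  so that the fixed point is jointly continuous in the parameter and the variable.\<close>

lemma radial_integral_equation_param:
  fixes H :: "real \<Rightarrow> real \<Rightarrow> real"
  assumes H: "continuous_on UNIV (\<lambda>(t, q). H t q)" and E: "continuous_on UNIV E"
    and bound: "\<And>t q. 0 \<le> H t q" "\<And>t q. H t q \<le> E t"
  obtains w where "continuous_on UNIV (\<lambda>(t, q). w t q)"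
    and "\<And>t q. w t q = radial_inv3 (\<lambda>r. H t r * exp (- 6 * \<bar>w t r\<bar>)) q"
proof -
  \<comment> \<open>The nonlinearity has Lipschitz constant at most \<open>6 * E t\<close>, so this
    choice gives the contraction factor \<open>6 * E t / L t \<le> 1 / 2\<close>, and also
    \<open>1 \<le> L t\<close>.\<close>
  define L where "L t = 1 + 12 * E t" for t
  have E0: "0 \<le> E t" for t using bound[of t 0] by linarith
  then have L: "1 \<le> L t" for t by (simp add: L_def)
  have cL: "continuous_on UNIV L" unfolding L_def[abs_def] by (intro continuous_intros E)
  \<comment> \<open>The unknown is the rescaled function \<open>g\<close>, with
    \<open>w t q = exp (L t * |q|) * g (t, q)\<close>.\<close>
  define N where "N g t r = H t r * exp (- 6 * \<bar>exp (L t * \<bar>r\<bar>) * g (t, r)\<bar>)"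
    for g :: "real \<times> real \<Rightarrow> real" and t r
  define T where "T g = (\<lambda>(t, q). exp (- L t * \<bar>q\<bar>) * radial_inv3 (N g t) q)"
    for g :: "real \<times> real \<Rightarrow> real"
  have cL': "continuous_on UNIV (\<lambda>p::real \<times> real. L (fst p))"
    by (rule continuous_on_compose2[OF cL]) (auto intro: continuous_intros)
  have cN: "continuous_on UNIV (\<lambda>(t, r). N g t r)" if "continuous_on UNIV g" for g
    using H that cL' unfolding N_def case_prod_unfold by (auto intro!: continuous_intros)
  have cN1: "continuous_on UNIV (N g t)" if "continuous_on UNIV g" for g t
  proof -
    have "continuous_on UNIV (\<lambda>r::real. (t, r))" by (intro continuous_intros)
    from continuous_on_compose2[OF cN[OF that] this] show ?thesis by simp
  qed
  have cT: "continuous_on UNIV (T g)" if g: "continuous_on UNIV g" for g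
    using continuous_on_radial_inv_param[OF continuous_on_radial_inv_param[OF
        continuous_on_radial_inv_param[OF cN[OF g]]]] cL'
    unfolding T_def case_prod_unfold by (auto intro!: continuous_intros)
  have weight: "exp (- L t * \<bar>q\<bar>) * \<bar>radial_inv3 h q\<bar> \<le> C / L t"
    if "continuous_on UNIV h" "\<And>r. \<bar>h r\<bar> \<le> C * exp (L t * \<bar>r\<bar>)" for h C t q
  proof -
    have "exp (- L t * \<bar>q\<bar>) * \<bar>radial_inv3 h q\<bar> \<le> exp (- L t * \<bar>q\<bar>) * (C / L t * exp (L t * \<bar>q\<bar>))"
      using that L by (intro mult_left_mono radial_inv3_abs_le_exp) auto
    then show ?thesis by (simp add: exp_minus field_simps)
  qed
  have NE: "\<bar>N g t r\<bar> \<le> E t * exp (L t * \<bar>r\<bar>)" for g t r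
  proof -
    have "\<bar>N g t r\<bar> \<le> E t * 1"
      unfolding N_def abs_mult using bound by (intro mult_mono E0) auto
    also have "\<dots> \<le> E t * exp (L t * \<bar>r\<bar>)"
      using L[of t] E0 by (intro mult_left_mono) auto
    finally show ?thesis .
  qed
  \<comment> \<open>\<open>E\<close> may be unbounded, but \<open>E t / L t \<le> 1\<close> holds
    uniformly in \<open>t\<close>; so the bounded continuous functions on the whole plane can serve
    as the complete space.\<close>
  have bT: "T g \<in> bcontfun" if g: "continuous_on UNIV g" for g
  proof -
    have "\<bar>T g p\<bar> \<le> 1" for p
    proof -
      obtain t q where p: "p = (t, q)" by fastforce
      have "\<bar>T g p\<bar> \<le> E t / L t"
        using weight[OF cN1[OF g] NE] by (simp add: T_def p abs_mult)
      also have "\<dots> \<le> 1"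
        using L[of t] E0[of t] by (simp add: L_def)
      finally show ?thesis .
    qed
    then have "bounded (range (T g))" by (auto simp: bounded_iff)
    then show ?thesis using cT[OF g] by (simp add: bcontfun_def)
  qed
  have "\<exists>!g. Bcontfun (T (apply_bcontfun g)) = g"
  proof (rule banach_fix_type[of "1 / 2"]; (intro allI)?)
    fix g1 g2 :: "(real \<times> real) \<Rightarrow>\<^sub>C real"
    show "dist (Bcontfun (T g1)) (Bcontfun (T g2)) \<le> 1 / 2 * dist g1 g2"
    proof (rule dist_bound)
      fix p :: "real \<times> real"
      obtain t q where p: "p = (t, q)" by fastforce
      let ?d = "dist g1 g2"
      have N12: "\<bar>N g1 t r - N g2 t r\<bar> \<le> (6 * E t * ?d) * exp (L t * \<bar>r\<bar>)" for r
      proof -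
        let ?e = "exp (L t * \<bar>r\<bar>)"
        have "\<bar>N g1 t r - N g2 t r\<bar> = H t r * \<bar>exp (- (6 * \<bar>?e * g1 (t, r)\<bar>)) - exp (- (6 * \<bar>?e * g2 (t, r)\<bar>))\<bar>"
          using bound by (simp add: N_def right_diff_distrib[symmetric] abs_mult)
        also have "\<dots> \<le> E t * \<bar>6 * \<bar>?e * g1 (t, r)\<bar> - 6 * \<bar>?e * g2 (t, r)\<bar>\<bar>"
          using bound E0 by (intro mult_mono abs_exp_neg_diff_le) auto
        also have "\<dots> \<le> E t * (6 * (?e * ?d))"
        proof (intro mult_left_mono E0)
          have "\<bar>6 * \<bar>?e * g1 (t, r)\<bar> - 6 * \<bar>?e * g2 (t, r)\<bar>\<bar> \<le> 6 * \<bar>?e * g1 (t, r) - ?e * g2 (t, r)\<bar>"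
            using abs_triangle_ineq3[of "?e * g1 (t, r)" "?e * g2 (t, r)"] by (simp only: right_diff_distrib[symmetric] abs_mult) simp
          also have "\<dots> = 6 * (?e * \<bar>g1 (t, r) - g2 (t, r)\<bar>)"
            by (simp add: right_diff_distrib[symmetric] abs_mult)
          also have "\<dots> \<le> 6 * (?e * ?d)"
            using dist_bounded[of g1 "(t, r)" g2] by (simp add: dist_real_def)
          finally show "\<bar>6 * \<bar>?e * g1 (t, r)\<bar> - 6 * \<bar>?e * g2 (t, r)\<bar>\<bar> \<le> 6 * (?e * ?d)" .
        qed
        finally show ?thesis by (simp add: mult_ac)
      qed
      have 1: "radial_inv3 (N g1 t) q - radial_inv3 (N g2 t) q = radial_inv3 (\<lambda>r. N g1 t r - N g2 t r) q"
        by (rule radial_inv3_diff[symmetric]; rule cN1; simp)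
      have "\<bar>T g1 p - T g2 p\<bar> = exp (- L t * \<bar>q\<bar>) * \<bar>radial_inv3 (\<lambda>r. N g1 t r - N g2 t r) q\<bar>"
        by (simp add: T_def p right_diff_distrib[symmetric] abs_mult 1)
      also have "\<dots> \<le> 6 * E t * ?d / L t"
        by (rule weight[OF _ N12]) (intro continuous_on_diff cN1 continuous_on_apply_bcontfun)
      also have "\<dots> = ?d * (6 * E t / L t)" by simp
      also have "\<dots> \<le> ?d * (1 / 2)"
        using L[of t] E0[of t] by (intro mult_left_mono) (auto simp: L_def field_simps)
      finally show "dist (Bcontfun (T g1) p) (Bcontfun (T g2) p) \<le> 1 / 2 * ?d"
        by (simp add: dist_real_def Bcontfun_inverse bT)
    qed
  qed auto
  then obtain g where g: "Bcontfun (T (apply_bcontfun g)) = g" by blast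
  have Tg: "T g p = g p" for p
    using Bcontfun_inverse[OF bT, of g] g by simp
  define w where "w t q = exp (L t * \<bar>q\<bar>) * g (t, q)" for t q
  show ?thesis
  proof
    show "continuous_on UNIV (\<lambda>(t, q). w t q)"
      using cL' unfolding w_def case_prod_unfold by (auto intro!: continuous_intros)
    fix t q
    have "w t q = exp (L t * \<bar>q\<bar>) * T g (t, q)" by (simp add: w_def Tg)
    also have "\<dots> = radial_inv3 (N g t) q" by (simp add: T_def exp_minus)
    finally show "w t q = radial_inv3 (\<lambda>r. H t r * exp (- 6 * \<bar>w t r\<bar>)) q"
      by (simp add: N_def[abs_def] w_def)
  qed
qed

subsection \<open>Integration of radial functions in even dimensions\<close>

text \<open>For \<open>a \<ge> 0\<close> the sublevel set is a ball of radius \<open>sqrt a\<close>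
  with volume \<open>unit_ball_vol (2 * k) * a ^ k\<close>, whose derivative in \<open>a\<close> is
  the density; the measures are compared on the generating half-lines \<open>{..a}\<close>.\<close>

lemma distr_inner_self_even_dim:
  assumes dim: "DIM('a::euclidean_space) = 2 * k" "0 < k"
  shows "distr lborel borel (\<lambda>x::'a. x \<bullet> x)
    = density lborel (\<lambda>q. ennreal (real k * unit_ball_vol (2 * k) * q ^ (k - 1)) * indicator {0..} q)"
    (is "?M = ?N")
proof (rule measure_eqI_generator_eq)
  let ?v = "unit_ball_vol (2 * k)"
  let ?E = "range (\<lambda>a::real. {..a})"
  show "Int_stable ?E"
    by (auto simp: Int_stable_def Int_atMost)
  show "?E \<subseteq> Pow UNIV" by simp
  have "sets borel = sigma_sets (UNIV :: real set) ?E"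
    unfolding borel_eq_atMost by (rule sets_measure_of) simp
  then show "sets ?M = sigma_sets UNIV ?E" "sets ?N = sigma_sets UNIV ?E" by simp_all
  have M: "emeasure ?M {..a} = (if 0 \<le> a then ennreal (?v * a ^ k) else 0)" for a
  proof -
    have "emeasure ?M {..a} = emeasure lborel {x::'a. x \<bullet> x \<le> a}"
      by (subst emeasure_distr) (auto simp: vimage_def)
    also have "\<dots> = (if 0 \<le> a then ennreal (?v * a ^ k) else 0)"
    proof (cases "0 \<le> a")
      case True
      then have "{x::'a. x \<bullet> x \<le> a} = cball 0 (sqrt a)"
        by (auto simp: norm_eq_sqrt_inner)
      moreover have "sqrt a ^ (2 * k) = a ^ k"
        using True by (simp add: power_mult)
      ultimately show ?thesis
        using True dim by (simp add: emeasure_cball)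
    next
      case False
      then have "{x::'a. x \<bullet> x \<le> a} = {}"
        using inner_ge_zero order_trans by blast
      then show ?thesis using False by simp
    qed
    finally show ?thesis .
  qed
  show "range (\<lambda>n. {..real n}) \<subseteq> ?E" by auto
  show "(\<Union>n. {..real n}) = UNIV" by (auto intro: real_arch_simple)
  show "emeasure ?M {..real n} \<noteq> \<infinity>" for n by (simp add: M)
  fix X assume "X \<in> ?E"
  then obtain a where X: "X = {..a}" by auto
  have "emeasure ?N X
      = (\<integral>\<^sup>+q. ennreal (real k * ?v * q ^ (k - 1)) * indicator {0..a} q \<partial>lborel)"
    unfolding X by (subst emeasure_density) (auto intro!: nn_integral_cong simp: indicator_def)
  also have "\<dots> = (if 0 \<le> a then ennreal (?v * a ^ k) else 0)"
  proof (cases "0 \<le> a")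
    case True
    then have "(\<integral>\<^sup>+q. ennreal (real k * ?v * q ^ (k - 1)) * indicator {0..a} q \<partial>lborel)
        = ennreal (?v * a ^ k - ?v * 0 ^ k)"
      by (intro nn_integral_FTC_Icc) (auto intro!: derivative_eq_intros)
    then show ?thesis using True dim by (simp add: zero_power)
  qed simp
  finally show "emeasure ?M X = emeasure ?N X" by (simp add: M X)
qed

lemma nn_integral_radial_even_dim:
  assumes "DIM('a::euclidean_space) = 2 * k" "0 < k" and [measurable]: "g \<in> borel_measurable borel"
  shows "(\<integral>\<^sup>+(x::'a). g (x \<bullet> x) \<partial>lborel)
    = (\<integral>\<^sup>+q. ennreal (real k * unit_ball_vol (2 * k) * q ^ (k - 1)) * indicator {0..} q * g q \<partial>lborel)"
proof -
  have "(\<integral>\<^sup>+(x::'a). g (x \<bullet> x) \<partial>lborel) = (\<integral>\<^sup>+q. g q \<partial>distr lborel borel (\<lambda>x::'a. x \<bullet> x))"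
    by (subst nn_integral_distr) auto
  then show ?thesis
    unfolding distr_inner_self_even_dim[OF assms(1,2)] by (subst (asm) nn_integral_density) auto
qed

text \<open>Up to a constant factor this is the majorant of the volume densities.\<close>

lemma integrable_exp_neg_inner_self:
  assumes dim: "DIM('a::euclidean_space) = 6"
  shows "integrable lborel (\<lambda>x::'a. exp (- 6 * (x \<bullet> x)))"
proof (rule integrableI_bounded)
  define C where "C = 3 * unit_ball_vol 6"
  have C: "0 \<le> C" by (simp add: C_def)
  have "(\<integral>\<^sup>+(x::'a). ennreal (exp (- 6 * (x \<bullet> x))) \<partial>lborel)
      = (\<integral>\<^sup>+q. ennreal (C * q ^ 2) * indicator {0..} q * ennreal (exp (- 6 * q)) \<partial>lborel)"
    using nn_integral_radial_even_dim[where 'a='a and k=3 and g="\<lambda>q. ennreal (exp (- 6 * q))"] dim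
    by (simp add: C_def)
  also have "\<dots> \<le> (\<integral>\<^sup>+q. ennreal (C * exp (- q)) * indicator {0..} q \<partial>lborel)"
  proof (rule nn_integral_mono)
    fix q :: real
    have "C * q ^ 2 * exp (- 6 * q) \<le> C * exp (- q)" if "0 \<le> q"
    proof -
      have "q ^ 2 \<le> exp q ^ 2"
        using that exp_ge_add_one_self[of q] by (intro power_mono) linarith+
      also have "\<dots> = exp (2 * q)" by (simp add: exp_double)
      also have "\<dots> \<le> exp (5 * q)" using that by simp
      finally have "q ^ 2 * exp (- 6 * q) \<le> exp (5 * q) * exp (- 6 * q)"
        by (rule mult_right_mono) simp
      also have "\<dots> = exp (- q)" by (simp add: exp_add[symmetric])
      finally show ?thesis using C by (simp add: mult_left_mono mult.assoc)
    qed
    then show "ennreal (C * q ^ 2) * indicator {0..} q * ennreal (exp (- 6 * q))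
        \<le> ennreal (C * exp (- q)) * indicator {0..} q"
      using C by (auto simp: indicator_def ennreal_mult[symmetric] intro!: ennreal_leI)
  qed
  also have "\<dots> = ennreal (0 - (- C * exp (- 0)))"
  proof (rule nn_integral_FTC_atLeast)
    show "((\<lambda>q. - C * exp (- q)) \<longlongrightarrow> 0) at_top"
      by (rule tendsto_mult_right_zero)
        (rule filterlim_compose[OF exp_at_bot filterlim_uminus_at_bot_at_top])
  qed (use C in \<open>auto intro!: derivative_eq_intros\<close>)
  also have "\<dots> < \<infinity>" by simp
  finally show "(\<integral>\<^sup>+(x::'a). ennreal (norm (exp (- 6 * (x \<bullet> x)))) \<partial>lborel) < \<infinity>" by simp
qed simp

text \<open>The left-hand side is the integral over the ball \<open>x \<bullet> x \<le> Q\<close>,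
  expressed in the variable \<open>q\<close>; so a large moment forces a large volume.\<close>

lemma moment_le_integral_radial:
  assumes dim: "DIM('a::euclidean_space) = 6"
    and g: "continuous_on UNIV g" "\<And>q. 0 \<le> g q"
    and int: "integrable lborel (\<lambda>x::'a. g (x \<bullet> x))" and "0 \<le> Q"
  shows "3 * unit_ball_vol 6 * (Q ^ 3 * moment 2 g Q) \<le> (\<integral>(x::'a). g (x \<bullet> x) \<partial>lborel)"
proof -
  define C where "C = 3 * unit_ball_vol 6"
  have C: "0 \<le> C" by (simp add: C_def)
  have [measurable]: "g \<in> borel_measurable borel"
    using g(1) by (rule borel_measurable_continuous_onI)
  have "(\<lambda>q. C * (q ^ 2 * g q)) integrable_on {0..Q}"
    by (intro integrable_continuous_interval continuous_intros continuous_on_subset[OF g(1)]) auto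
  then have "((\<lambda>q. C * (q ^ 2 * g q)) has_integral integral {0..Q} (\<lambda>q. C * (q ^ 2 * g q))) {0..Q}"
    by (rule integrable_integral)
  moreover have "integral {0..Q} (\<lambda>q. C * (q ^ 2 * g q)) = C * (Q ^ 3 * moment 2 g Q)"
    using moment_eq_integral[OF g(1) \<open>0 \<le> Q\<close>, of 2] by simp
  ultimately have I: "((\<lambda>q. C * (q ^ 2 * g q)) has_integral C * (Q ^ 3 * moment 2 g Q)) {0..Q}"
    by metis
  have "ennreal (C * (Q ^ 3 * moment 2 g Q))
      = (\<integral>\<^sup>+q. ennreal (C * (q ^ 2 * g q)) * indicator {0..Q} q \<partial>lborel)"
    by (rule nn_integral_has_integral_lebesgue'[OF _ I, symmetric]) (use C g(2) in simp)
  also have "\<dots> \<le> (\<integral>\<^sup>+q. ennreal (C * q ^ 2) * indicator {0..} q * ennreal (g q) \<partial>lborel)"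
    by (rule nn_integral_mono) (use C g(2) in \<open>auto simp: indicator_def ennreal_mult[symmetric] mult_ac\<close>)
  also have "\<dots> = (\<integral>\<^sup>+(x::'a). ennreal (g (x \<bullet> x)) \<partial>lborel)"
    using nn_integral_radial_even_dim[where 'a='a and k=3 and g="\<lambda>q. ennreal (g q)"] dim
    by (simp add: C_def)
  also have "\<dots> = ennreal (\<integral>(x::'a). g (x \<bullet> x) \<partial>lborel)"
    by (rule nn_integral_eq_integral[OF int]) (simp add: g)
  finally show ?thesis
    using g by (subst (asm) ennreal_le_iff) (auto simp: C_def)
qed

subsection \<open>A one-parameter family of radial solutions\<close>

text \<open>Every quadratic polynomial in \<open>q = x \<bullet> x\<close> is annihilated by the third power of the Laplacian; the
  coefficients follow a curve along which the volume will turn out to be unbounded.\<close>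

definition radial_solution :: "real \<Rightarrow> (real \<Rightarrow> real) \<Rightarrow> bool" where
  "radial_solution t f \<longleftrightarrow> continuous_on UNIV f \<and>
     (\<forall>q\<ge>0. f q = - t + q - q ^ 2 / (1 + t ^ 2) - radial_inv3 (\<lambda>r. 120 * exp (6 * f r)) q)"

lemma radial_solution_continuous: "radial_solution t f \<Longrightarrow> continuous_on UNIV f"
  by (simp add: radial_solution_def)

lemma radial_solution_nonlinearity_continuous:
  "radial_solution t f \<Longrightarrow> continuous_on UNIV (\<lambda>r. 120 * exp (6 * f r))"
  by (intro continuous_intros radial_solution_continuous)

lemma radial_solution_eq:
  "radial_solution t f \<Longrightarrow> 0 \<le> q \<Longrightarrow>
    f q = - t + q - q ^ 2 / (1 + t ^ 2) - radial_inv3 (\<lambda>r. 120 * exp (6 * f r)) q"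
  by (simp add: radial_solution_def)

lemma radial_solution_le:
  assumes "radial_solution t f" "0 \<le> q"
  shows "f q \<le> - t + q - q ^ 2 / (1 + t ^ 2)"
proof -
  have "0 \<le> radial_inv3 (\<lambda>r. 120 * exp (6 * f r)) q"
    using assms by (intro radial_inv_nonneg continuous_on_radial_inv
      radial_solution_nonlinearity_continuous) auto
  then show ?thesis using radial_solution_eq[OF assms] by linarith
qed

lemma radial_solution_family:
  obtains f where "continuous_on UNIV (\<lambda>(t, q). f t q)" "\<And>t. radial_solution t (f t)"
proof -
  define P :: "real \<Rightarrow> real \<Rightarrow> real" where "P t q = - t + q - q ^ 2 / (1 + t ^ 2)" for t q
  define H where "H t q = 120 * exp (6 * P t q)" for t q
  \<comment> \<open>\<open>E\<close> comes from the maximum of \<open>P t\<close>, attained at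
    \<open>q = (1 + t ^ 2) / 2\<close>.\<close>
  define E where "E t = 120 * exp (6 * (- t + (1 + t ^ 2) / 4))" for t :: real
  have pos: "1 + t ^ 2 \<noteq> 0" for t :: real
    using zero_le_power2[of t] by linarith
  have cP: "continuous_on UNIV (\<lambda>(t, q). P t q)"
    unfolding P_def case_prod_unfold using pos by (intro continuous_intros) auto
  have cH: "continuous_on UNIV (\<lambda>(t, q). H t q)"
    using cP unfolding H_def case_prod_unfold by (intro continuous_intros)
  have cE: "continuous_on UNIV E"
    unfolding E_def[abs_def] by (intro continuous_intros) auto
  have HE: "H t q \<le> E t" for t q
  proof -
    define K where "K = 1 + t ^ 2"
    have K: "0 < K" unfolding K_def using zero_le_power2[of t] by linarith
    have "0 \<le> (K / 2 - q) ^ 2" by simp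
    then have "q * K - q ^ 2 \<le> K * (K / 4)"
      by (simp add: power2_eq_square algebra_simps)
    then have "q - q ^ 2 / K \<le> K / 4"
      using K by (simp add: field_simps power2_eq_square)
    then show ?thesis by (simp add: H_def E_def P_def K_def)
  qed
  have H0: "0 \<le> H t q" for t q by (simp add: H_def)
  \<comment> \<open>\<open>w\<close> is the deficit \<open>P - f\<close>, nonnegative on the half-line; the absolute value keeps the
    nonlinearity bounded and Lipschitz where the sign is not yet known\<close>
  obtain w where cw: "continuous_on UNIV (\<lambda>(t, q). w t q)"
    and w: "\<And>t q. w t q = radial_inv3 (\<lambda>r. H t r * exp (- 6 * \<bar>w t r\<bar>)) q"
    by (rule radial_integral_equation_param[OF cH cE H0 HE]) blast
  define f where "f t q = P t q - w t q" for t q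
  have cf: "continuous_on UNIV (\<lambda>(t, q). f t q)"
    using cP cw unfolding f_def case_prod_unfold by (intro continuous_intros)
  have slice: "continuous_on UNIV (F t)" if "continuous_on UNIV (\<lambda>(t, q). F t q)"
    for F :: "real \<Rightarrow> real \<Rightarrow> real" and t
  proof -
    have "continuous_on UNIV (\<lambda>r::real. (t, r))" by (intro continuous_intros)
    from continuous_on_compose2[OF that this] show ?thesis by simp
  qed
  have "radial_solution t (f t)" for t
  proof -
    have cN: "continuous_on UNIV (\<lambda>r. H t r * exp (- 6 * \<bar>w t r\<bar>))"
      using slice[OF cH, of t] slice[OF cw, of t] by (intro continuous_intros)
    have w0: "0 \<le> w t q" if "0 \<le> q" for q
      unfolding w[of t q] using that cN
      by (intro radial_inv_nonneg continuous_on_radial_inv) (auto simp: H_def)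
    \<comment> \<open>With \<open>0 \<le> w\<close> the absolute value disappears and the two
      exponentials combine to \<open>exp (6 * f t r)\<close>.\<close>
    have "w t q = radial_inv3 (\<lambda>r. 120 * exp (6 * f t r)) q" if "0 \<le> q" for q
      unfolding w[of t q] using that
      by (intro radial_inv_cong)
        (auto simp: H_def f_def w0 exp_add[symmetric] algebra_simps)
    then show ?thesis
      using slice[OF cf] by (simp add: radial_solution_def f_def P_def)
  qed
  with cf that show thesis by blast
qed

text \<open>Bootstrapping: the exponential is as regular as \<open>f\<close>, and the three inverses
  gain three derivatives, of which the induction needs one.\<close>

lemma half_C_k_radial_solution:
  assumes f: "radial_solution t f"
  shows "half_C_k k f"
proof (induction k)
  case 0
  then show ?case using continuous_on_subset[OF radial_solution_continuous[OF f]] by simp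
next
  case (Suc k)
  let ?h = "\<lambda>r. 120 * exp (6 * f r)"
  have c: "continuous_on UNIV ?h" by (rule radial_solution_nonlinearity_continuous[OF f])
  have id: "half_C_k j (\<lambda>q. q)" for j
    by (cases j) (auto intro!: exI[of _ "\<lambda>_. 1"] half_C_k_const continuous_intros)
  have "half_C_k k ?h"
    by (intro half_C_k_mult half_C_k_const half_C_k_exp Suc.IH)
  then have "half_C_k (Suc (Suc (Suc k))) (radial_inv3 ?h)"
    by (intro half_C_k_radial_inv continuous_on_radial_inv c)
  then have "half_C_k (Suc k) (radial_inv3 ?h)"
    by (metis half_C_k_SucD)
  \<comment> \<open>The quadratic is spelled with sums and products only, to match the closure rules
    of \<open>half_C_k\<close>.\<close>
  then have "half_C_k (Suc k) (\<lambda>q. - t + (q + ((- 1 / (1 + t ^ 2)) * (q * q) + (- 1) * radial_inv3 ?h q)))"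
    by (intro half_C_k_add half_C_k_mult half_C_k_const id)
  then show ?case
    by (rule half_C_k_cong) (simp add: radial_solution_eq[OF f] power2_eq_square)
qed

lemma radial_solution_neg_laplacian_power:
  fixes x :: "'a::euclidean_space"
  assumes dim: "DIM('a) = 6" and f: "radial_solution t f"
  shows "neg_laplacian_power 3 (\<lambda>x::'a. f (x \<bullet> x)) x = 120 * exp (6 * f (x \<bullet> x))"
proof -
  define h where "h r = 120 * exp (6 * f r)" for r
  define c where "c = 1 / (1 + t ^ 2)"
  \<comment> \<open>The Laplacian maps \<open>q ^ 2\<close> to \<open>32 * q\<close> and
    \<open>q\<close> to \<open>12\<close>, whence \<open>384 = 32 * 12\<close>; \<open>f1\<close>
    and \<open>- f2\<close> will be the first two iterated Laplacians of the solution.\<close>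
  define d where "d = 384 * c"
  define f2 where "f2 q = d + radial_inv h q" for q
  define f1 where "f1 q = 12 - radial_inv f2 q" for q
  have ch: "continuous_on UNIV h"
    unfolding h_def by (rule radial_solution_nonlinearity_continuous[OF f])
  have c2: "continuous_on UNIV f2"
    unfolding f2_def by (intro continuous_intros continuous_on_radial_inv ch)
  have c1: "continuous_on UNIV f1"
    unfolding f1_def by (intro continuous_intros continuous_on_radial_inv c2)
  have sh: "half_C_k k h" for k
    unfolding h_def by (intro half_C_k_mult half_C_k_const half_C_k_exp half_C_k_radial_solution[OF f])
  have s2: "half_C_k k f2" for k
    unfolding f2_def using half_C_k_SucD[OF half_C_k_radial_inv[OF ch sh]]
    by (intro half_C_k_add half_C_k_const)
  have "half_C_k k (\<lambda>q. 12 + (- 1) * radial_inv f2 q)" for k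
    using half_C_k_SucD[OF half_C_k_radial_inv[OF c2 s2]]
    by (intro half_C_k_add half_C_k_mult half_C_k_const)
  then have s1: "half_C_k k f1" for k unfolding f1_def by simp
  note cont = continuous_intros continuous_on_radial_inv ch
  have I2: "radial_inv f2 q = d * q / 12 + radial_inv (radial_inv h) q" for q
  proof -
    \<comment> \<open>Constants appear as multiples of \<open>r ^ 0\<close> and signs as factors
      \<open>- 1\<close>, so that \<open>radial_inv_cmult\<close> and
      \<open>radial_inv_power\<close> can evaluate each term.\<close>
    have "radial_inv f2 q = radial_inv (\<lambda>r. d * r ^ 0 - (- 1) * radial_inv h r) q"
      by (simp add: f2_def[abs_def])
    also have "\<dots> = radial_inv (\<lambda>r. d * r ^ 0) q - radial_inv (\<lambda>r. (- 1) * radial_inv h r) q"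
      by (rule radial_inv_diff; intro cont)
    also have "\<dots> = d * q / 12 + radial_inv (radial_inv h) q"
      unfolding radial_inv_cmult radial_inv_power by simp
    finally show ?thesis .
  qed
  have I1: "radial_inv f1 q = q - d / 384 * q ^ 2 - radial_inv3 h q" for q
  proof -
    have "f1 = (\<lambda>r. 12 * r ^ 0 - (d / 12 * r ^ 1 - (- 1) * radial_inv (radial_inv h) r))"
      by (simp add: f1_def[abs_def] I2)
    then have "radial_inv f1 q
        = radial_inv (\<lambda>r. 12 * r ^ 0 - (d / 12 * r ^ 1 - (- 1) * radial_inv (radial_inv h) r)) q"
      by (rule arg_cong)
    also have "\<dots> = radial_inv (\<lambda>r. 12 * r ^ 0) q
        - radial_inv (\<lambda>r. d / 12 * r ^ 1 - (- 1) * radial_inv (radial_inv h) r) q"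
      by (rule radial_inv_diff; intro cont)
    also have "radial_inv (\<lambda>r. d / 12 * r ^ 1 - (- 1) * radial_inv (radial_inv h) r) q
        = radial_inv (\<lambda>r. d / 12 * r ^ 1) q - radial_inv (\<lambda>r. (- 1) * radial_inv (radial_inv h) r) q"
      by (rule radial_inv_diff; intro cont)
    finally show ?thesis
      unfolding radial_inv_cmult radial_inv_power by (simp add: power2_eq_square)
  qed
  have e: "f q = - t + 1 * radial_inv f1 q" if "0 \<le> q" for q
  proof -
    have "q ^ 2 / (1 + t ^ 2) = c * q ^ 2" by (simp add: c_def)
    then show ?thesis
      using radial_solution_eq[OF f that] by (simp add: I1 d_def h_def[abs_def])
  qed
  have L1: "(\<lambda>x::'a. - laplacian (\<lambda>x. f (x \<bullet> x)) x) = (\<lambda>x. - f1 (x \<bullet> x))"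
    using laplacian_radial_inv[OF dim c1 s1 e] by (intro ext) simp
  have L2: "(\<lambda>x::'a. - laplacian (\<lambda>x. - f1 (x \<bullet> x)) x) = (\<lambda>x. - f2 (x \<bullet> x))"
    using laplacian_radial_inv[OF dim c2 s2, of "\<lambda>q. - f1 q" "- 12" 1]
    by (intro ext) (simp add: f1_def)
  have L3: "(\<lambda>x::'a. - laplacian (\<lambda>x. - f2 (x \<bullet> x)) x) = (\<lambda>x. h (x \<bullet> x))"
    using laplacian_radial_inv[OF dim ch sh, of "\<lambda>q. - f2 q" "- d" "- 1"]
    by (intro ext) (simp add: f2_def)
  show ?thesis
    by (simp add: neg_laplacian_power_def numeral_3_eq_3 L1 L2 L3 h_def[symmetric])
qed

subsection \<open>Blow-up of the volume\<close>

text \<open>Up to the factor \<open>3 * unit_ball_vol 6\<close> the right-hand side is the volume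
  inside a ball. If it never exceeded \<open>M\<close>, this bound would keep \<open>f\<close>
  nonnegative on \<open>{Q / 2..Q}\<close> for a suitable \<open>Q\<close>, making the moment too
  large.\<close>

lemma radial_solution_moment_unbounded:
  assumes f: "radial_solution t f" and "0 \<le> M" and t: "t = 8 * (3 + 27 * M)"
  shows "\<exists>Q\<ge>0. M < Q ^ 3 * moment 2 (\<lambda>r. exp (6 * f r)) Q"
proof (rule ccontr)
  define g where "g r = exp (6 * f r)" for r
  \<comment> \<open>\<open>C\<close> covers both constants found below, \<open>9 / 8\<close> for
    small radii and \<open>27 * M\<close> for large ones; \<open>K = C + 1\<close> also absorbs the
    term \<open>q ^ 2 / (1 + t ^ 2)\<close>.\<close>
  define C K where "C = 2 + 27 * M" and "K = 3 + 27 * M"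
  have pos: "0 < t" "0 < K" "0 < C" "1 \<le> K" using assms by (auto simp: C_def K_def)
  have tK: "t = 8 * K" by (simp add: t K_def)
  have cg: "continuous_on UNIV g"
    unfolding g_def by (intro continuous_intros radial_solution_continuous[OF f])
  assume "\<not> ?thesis"
  then have M: "Q ^ 3 * moment 2 g Q \<le> M" if "0 \<le> Q" for Q
    using that unfolding g_def by fastforce
  \<comment> \<open>small radii: \<open>f r \<le> r - t\<close>; large radii: the mass bound\<close>
  have decay: "moment 2 g r \<le> C / (t + r) ^ 3" if r: "0 \<le> r" for r
  proof -
    have "moment 2 g r * (t + r) ^ 3 \<le> C"
    proof (cases "r \<le> t / 2")
      case True
      have "moment 2 g r \<le> moment 2 (\<lambda>s. exp (- 3 * t) * s ^ 0) r"
      proof (rule moment_mono[OF cg _ r])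
        fix s assume s: "0 \<le> s" "s \<le> r"
        have "0 \<le> s ^ 2 / (1 + t ^ 2)" by simp
        with radial_solution_le[OF f s(1)] have "6 * f s \<le> - 3 * t" using s True by linarith
        then show "g s \<le> exp (- 3 * t) * s ^ 0" by (simp add: g_def)
      qed simp
      also have "\<dots> = exp (- 3 * t) / 3"
        unfolding moment_cmult moment_power by simp
      finally have "moment 2 g r * (t + r) ^ 3 \<le> exp (- 3 * t) / 3 * (3 / 2 * t) ^ 3"
        using pos r True by (intro mult_mono power_mono) auto
      also have "\<dots> = 9 / 8 * (exp (- 3 * t) * t ^ 3)"
        by (simp add: power3_eq_cube)
      also have "exp (- 3 * t) * t ^ 3 \<le> exp (- 3 * t) * exp t ^ 3"
        using pos exp_ge_add_one_self[of t] by (intro mult_left_mono power_mono) (linarith | rule exp_ge_zero)+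
      also have "\<dots> = 1"
        by (simp add: exp_of_nat_mult[symmetric] exp_add[symmetric])
      finally show ?thesis using \<open>0 \<le> M\<close> by (simp add: C_def)
    next
      case False
      have "0 \<le> moment 2 g r"
        using moment_mono[of "\<lambda>s. 0 * s ^ 0" g r 2] cg r by (simp only: moment_cmult) (simp add: g_def)
      then have "moment 2 g r * (t + r) ^ 3 \<le> moment 2 g r * (3 * r) ^ 3"
        using pos r False by (intro mult_left_mono power_mono) auto
      also have "\<dots> = 27 * (r ^ 3 * moment 2 g r)" by (simp add: power_mult_distrib)
      also have "\<dots> \<le> 27 * M" using M[OF r] by simp
      finally show ?thesis by (simp add: C_def)
    qed
    then show ?thesis using pos r by (simp add: pos_le_divide_eq)
  qed
  \<comment> \<open>Integrating the cubic decay gives a bound independent of \<open>q\<close>, with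
    \<open>15 = 120 / (4 * 2)\<close>.\<close>
  have inv1: "radial_inv (\<lambda>r. 120 * g r) q \<le> 15 * C / t ^ 2" if q: "0 \<le> q" for q
  proof -
    have I: "((\<lambda>r. C * inverse (t + r) ^ 3) has_integral
        - C / 2 * inverse (t + q) ^ 2 - - C / 2 * inverse (t + 0) ^ 2) {0..q}"
    proof (rule fundamental_theorem_of_calculus)
      fix r assume "r \<in> {0..q}"
      then have "t + r \<noteq> 0" using pos by auto
      then have "((\<lambda>r. - C / 2 * inverse (t + r) ^ 2) has_real_derivative C * inverse (t + r) ^ 3)
          (at r within {0..q})"
        by (auto intro!: derivative_eq_intros simp: power2_eq_square power3_eq_cube)
      then show "((\<lambda>r. - C / 2 * inverse (t + r) ^ 2) has_vector_derivative C * inverse (t + r) ^ 3)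
          (at r within {0..q})"
        by (simp add: has_real_derivative_iff_has_vector_derivative)
    qed (use q in simp)
    have "q * moment 0 (moment 2 g) q = integral {0..q} (moment 2 g)"
      using moment_eq_integral[OF continuous_on_moment[OF cg] q, of 0 2] by simp
    also have "\<dots> \<le> - C / 2 * inverse (t + q) ^ 2 - - C / 2 * inverse (t + 0) ^ 2"
    proof (rule has_integral_le[OF integrable_integral I])
      show "moment 2 g integrable_on {0..q}"
        by (intro integrable_continuous_interval continuous_on_subset[OF continuous_on_moment[OF cg]]) simp
    next
      fix r assume "r \<in> {0..q}"
      then show "moment 2 g r \<le> C * inverse (t + r) ^ 3"
        using decay[of r] unfolding divide_inverse power_inverse by simp
    qed
    also have "\<dots> \<le> C / (2 * t ^ 2)" using pos by (simp add: field_simps)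
    finally have "q * moment 0 (moment 2 g) q \<le> C / (2 * t ^ 2)" .
    then show ?thesis
      unfolding radial_inv_cmult by (simp add: radial_inv_def)
  qed
  have lower: "- t + q - K * q ^ 2 / t ^ 2 \<le> f q" if q: "0 \<le> q" for q
  proof -
    have c: "continuous_on UNIV (\<lambda>r. 120 * g r)" by (intro continuous_intros cg)
    have "radial_inv3 (\<lambda>r. 120 * g r) q \<le> radial_inv (radial_inv (\<lambda>r. 15 * C / t ^ 2 * r ^ 0)) q"
      by (intro radial_inv_mono continuous_on_radial_inv c q continuous_intros) (auto simp: inv1)
    also have "\<dots> = 15 * C / t ^ 2 * (q ^ 2 / 384)"
    proof -
      have "radial_inv (\<lambda>r. 15 * C / t ^ 2 * r ^ 0) = (\<lambda>r. 15 * C / t ^ 2 / 12 * r ^ 1)"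
        by (rule ext) (simp only: radial_inv_cmult radial_inv_power, simp)
      then show ?thesis
        by (simp only: radial_inv_cmult radial_inv_power) (simp add: power2_eq_square)
    qed
    also have "\<dots> \<le> C * q ^ 2 / t ^ 2"
      using pos by (simp add: field_simps)
    finally have 1: "radial_inv3 (\<lambda>r. 120 * g r) q \<le> C * q ^ 2 / t ^ 2" .
    have "q ^ 2 / (1 + t ^ 2) \<le> q ^ 2 / t ^ 2"
      using pos by (intro divide_left_mono) (auto intro!: mult_pos_pos add_pos_pos)
    moreover have "K * q ^ 2 / t ^ 2 = q ^ 2 / t ^ 2 + C * q ^ 2 / t ^ 2"
      by (simp add: K_def C_def add_divide_distrib[symmetric] algebra_simps)
    ultimately show ?thesis
      using 1 radial_solution_eq[OF f q] by (simp add: g_def)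
  qed
  \<comment> \<open>As \<open>t = 8 * K\<close>, this is \<open>t ^ 2 / (2 * K)\<close>, the maximum
    point of the lower bound for \<open>f\<close>; half of it is \<open>2 * t\<close>, where that
    bound is already nonnegative.\<close>
  define Q where "Q = 32 * K"
  \<comment> \<open>\<open>f \<ge> 0\<close> on \<open>{Q / 2..Q}\<close>, so the affine function \<open>2 * r / Q - 1\<close> is a continuous minorant of \<open>g\<close> on \<open>{0..Q}\<close>\<close>
  have "moment 2 (\<lambda>r. 2 / Q * r ^ 1 - 1 * r ^ 0) Q \<le> moment 2 g Q"
  proof (rule moment_mono)
    fix r assume r: "0 \<le> r" "r \<le> Q"
    show "2 / Q * r ^ 1 - 1 * r ^ 0 \<le> g r"
    proof (cases "r \<le> Q / 2")
      case True
      then have "2 / Q * r ^ 1 - 1 * r ^ 0 \<le> 0" using pos by (simp add: Q_def field_simps)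
      also have "0 \<le> g r" by (simp add: g_def)
      finally show ?thesis .
    next
      case False
      have "K * r ^ 2 / t ^ 2 = r * (r / (64 * K))"
        using pos by (simp add: tK power2_eq_square)
      also have "\<dots> \<le> r * (1 / 2)"
        using r pos by (intro mult_left_mono) (auto simp: Q_def field_simps)
      finally have "0 \<le> f r" using lower[OF r(1)] False tK by (simp add: Q_def)
      then have "1 \<le> g r" by (simp add: g_def)
      moreover have "2 / Q * r ^ 1 - 1 * r ^ 0 \<le> 1" using r pos by (simp add: Q_def field_simps)
      ultimately show ?thesis by linarith
    qed
  qed (use pos in \<open>auto intro!: continuous_intros cg simp: Q_def\<close>)
  \<comment> \<open>The two terms contribute \<open>1 / 2\<close> and \<open>1 / 3\<close>.\<close>
  also have "moment 2 (\<lambda>r. 2 / Q * r ^ 1 - 1 * r ^ 0) Q = 1 / 6"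
    by (subst moment_diff; (intro continuous_intros)?; simp only: moment_cmult moment_power)
      (use pos in \<open>simp add: Q_def\<close>)
  finally have "Q ^ 3 * (1 / 6) \<le> Q ^ 3 * moment 2 g Q"
    using pos by (intro mult_left_mono) (auto simp: Q_def)
  also have "\<dots> \<le> M" by (rule M) (use pos in \<open>simp add: Q_def\<close>)
  finally have "Q ^ 3 \<le> 6 * M" by simp
  \<comment> \<open>Since \<open>1 \<le> Q\<close>, this leaves \<open>Q \<le> 6 * M\<close>,
    against \<open>Q = 32 * (3 + 27 * M)\<close>.\<close>
  moreover have "Q ^ 1 \<le> Q ^ 3" using pos by (intro power_increasing) (auto simp: Q_def)
  ultimately show False using \<open>0 \<le> M\<close> by (simp add: Q_def K_def)
qed

text \<open>Provides a majorant uniform for \<open>|t| \<le> T\<close>: with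
  \<open>K = 1 + T ^ 2\<close>, completing the square gives
  \<open>2 * q - q ^ 2 / K \<le> K\<close>, which trades the quadratic decay for
  \<open>exp (- 6 * q)\<close>.\<close>

lemma radial_solution_exp_le:
  assumes "radial_solution t f" "0 \<le> q" "\<bar>t\<bar> \<le> T"
  shows "exp (6 * f q) \<le> exp (6 * (T + (1 + T ^ 2))) * exp (- 6 * q)"
proof -
  define K where "K = 1 + T ^ 2"
  have K: "0 < K" unfolding K_def using zero_le_power2[of T] by linarith
  have "t ^ 2 \<le> T ^ 2" using power_mono[OF assms(3), of 2] by simp
  then have "q ^ 2 / K \<le> q ^ 2 / (1 + t ^ 2)"
    unfolding K_def by (intro divide_left_mono) (auto intro!: mult_pos_pos add_pos_nonneg)
  moreover have "0 \<le> (K - q) ^ 2" by simp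
  then have "2 * q - q ^ 2 / K \<le> K"
    using K by (simp add: field_simps power2_eq_square)
  ultimately have "f q \<le> T + K - q"
    using radial_solution_le[OF assms(1,2)] assms(3) by linarith
  then show ?thesis unfolding exp_add[symmetric] by (simp add: K_def)
qed

theorem theorem1:
  shows "\<exists>Vstar::real. Vstar > 0 \<and> (\<forall>V::real. V \<ge> Vstar \<longrightarrow>
    (\<exists>u :: real ^ 6 \<Rightarrow> real. smooth u \<and>
       (\<forall>x. neg_laplacian_power 3 u x = fact 5 * exp (6 * u x)) \<and>
       has_bochner_integral lborel (\<lambda>x. exp (6 * u x)) V \<and>
       (\<forall>x. Q_curvature 3 u x = fact 5) \<and>
       conformal_volume 3 u = ennreal V))"
proof -
  obtain f where cf: "continuous_on UNIV (\<lambda>(t, q). f t q)" and f: "\<And>t. radial_solution t (f t)"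
    by (rule radial_solution_family) blast
  define e where "e t x = exp (6 * f t (x \<bullet> x))" for t and x :: "real ^ 6"
  define vol where "vol t = (\<integral>x. e t x \<partial>lborel)" for t
  define bound where "bound T x = exp (6 * (T + (1 + T ^ 2))) * exp (- 6 * (x \<bullet> x))"
    for T and x :: "real ^ 6"
  have dim: "DIM(real ^ 6) = 6" by simp
  have ce: "continuous_on UNIV (\<lambda>x. e t x)" for t
  proof -
    have "continuous_on UNIV (\<lambda>x::real ^ 6. f t (x \<bullet> x))"
      by (rule continuous_on_compose2[OF radial_solution_continuous[OF f]]) (auto intro!: continuous_intros)
    then show ?thesis unfolding e_def by (intro continuous_intros)
  qed
  then have [measurable]: "e t \<in> borel_measurable borel" for t
    by (rule borel_measurable_continuous_onI)
  have ebound: "norm (e t x) \<le> bound T x" if "\<bar>t\<bar> \<le> T" for t T x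
    using radial_solution_exp_le[OF f _ that, of "x \<bullet> x"] by (simp add: e_def bound_def)
  have ibound: "integrable lborel (bound T)" for T
    unfolding bound_def by (intro integrable_mult_right integrable_exp_neg_inner_self dim)
  have int: "integrable lborel (e t)" for t
    by (rule Bochner_Integration.integrable_bound[OF ibound[of "\<bar>t\<bar>"]])
      (use ebound[of t "\<bar>t\<bar>"] in \<open>auto simp: bound_def\<close>)
  \<comment> \<open>Continuity is tested on sequences in order to apply dominated convergence with
    the majorant \<open>bound T\<close>.\<close>
  have cvol: "continuous_on {0..T} vol" for T
    unfolding continuous_on_sequentially
  proof (intro allI ballI impI, elim conjE)
    fix s a assume s: "\<forall>n. s n \<in> {0..T}" "s \<longlonglongrightarrow> a"
    have "(\<lambda>n. \<integral>x. e (s n) x \<partial>lborel) \<longlonglongrightarrow> (\<integral>x. e a x \<partial>lborel)"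
    proof (rule integral_dominated_convergence[where w="bound T"])
      have "(\<lambda>n. (\<lambda>(t, q). f t q) (s n, x \<bullet> x)) \<longlonglongrightarrow> (\<lambda>(t, q). f t q) (a, x \<bullet> x)" for x :: "real ^ 6"
        by (rule continuous_on_tendsto_compose[OF cf]) (auto intro!: tendsto_intros s(2))
      then show "AE x in lborel. (\<lambda>n. e (s n) x) \<longlonglongrightarrow> e a x"
        by (auto simp: e_def intro!: tendsto_intros)
      show "AE x in lborel. norm (e (s n) x) \<le> bound T x" for n
        using s(1) by (intro AE_I2 ebound) auto
    qed (use ibound in auto)
    then show "(vol \<circ> s) \<longlonglongrightarrow> vol a" by (simp add: vol_def o_def)
  qed
  show ?thesis
  \<comment> \<open>\<open>vol 0\<close> is the starting value for the intermediate value theorem on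
    \<open>{0..T}\<close>; the \<open>1\<close> makes the threshold visibly positive.\<close>
  proof (intro exI[of _ "max 1 (vol 0)"] conjI allI impI)
    fix V assume V: "max 1 (vol 0) \<le> V"
    \<comment> \<open>Chosen so that, by \<open>moment_le_integral_radial\<close>, a moment above
      \<open>M\<close> forces a volume of at least \<open>V\<close>.\<close>
    define M where "M = V / (3 * unit_ball_vol 6)"
    have v: "0 < unit_ball_vol 6" by simp
    have "0 \<le> M" using V v by (simp add: M_def)
    define T where "T = 8 * (3 + 27 * M)"
    obtain Q where Q: "0 \<le> Q" "M < Q ^ 3 * moment 2 (\<lambda>r. exp (6 * f T r)) Q"
      using radial_solution_moment_unbounded[OF f \<open>0 \<le> M\<close> T_def] by blast
    have "V = 3 * unit_ball_vol 6 * M" using less_imp_neq[OF v] by (simp add: M_def)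
    also have "\<dots> \<le> 3 * unit_ball_vol 6 * (Q ^ 3 * moment 2 (\<lambda>r. exp (6 * f T r)) Q)"
      using Q v by (intro mult_left_mono) auto
    also have "\<dots> \<le> vol T"
      unfolding vol_def e_def
      by (rule moment_le_integral_radial[OF dim _ _ _ Q(1)])
        (use int[of T] in \<open>auto simp: e_def[abs_def] intro!: continuous_intros radial_solution_continuous[OF f]\<close>)
    finally obtain t where t: "vol t = V"
      using IVT'[of vol 0 V T, OF _ _ _ cvol] V \<open>0 \<le> M\<close> by (auto simp: T_def)
    define u where "u x = f t (x \<bullet> x)" for x :: "real ^ 6"
    have eu: "e t = (\<lambda>x. exp (6 * u x))" by (simp add: e_def[abs_def] u_def)
    have eq: "neg_laplacian_power 3 u x = fact 5 * exp (6 * u x)" for x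
      using radial_solution_neg_laplacian_power[OF dim f, of t x]
      by (simp add: u_def[abs_def] fact_numeral)
    have hb: "has_bochner_integral lborel (\<lambda>x. exp (6 * u x)) V"
      using int[of t] t unfolding vol_def eu by (simp add: has_bochner_integral_iff)
    show "\<exists>u :: real ^ 6 \<Rightarrow> real. smooth u \<and>
       (\<forall>x. neg_laplacian_power 3 u x = fact 5 * exp (6 * u x)) \<and>
       has_bochner_integral lborel (\<lambda>x. exp (6 * u x)) V \<and>
       (\<forall>x. Q_curvature 3 u x = fact 5) \<and>
       conformal_volume 3 u = ennreal V"
    proof (intro exI[of _ u] conjI allI)
      show "smooth u"
        unfolding smooth_def u_def[abs_def] by (intro allI C_k_radial half_C_k_radial_solution[OF f])
      show "Q_curvature 3 u x = fact 5" for x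
        by (simp add: Q_curvature_def eq exp_minus)
      show "conformal_volume 3 u = ennreal V"
        using hb by (simp add: conformal_volume_def has_bochner_integral_iff nn_integral_eq_integral)
    qed (rule eq hb)+
  qed simp
qed

end
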